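(* Let $1\le m_1<m$ and $H\ge 1$ be integers, and let $\mathbf{W}_1^1,\ldots,\mathbf{W}_1^H\in\mathbb{R}^{m_1\times m}$ be matrices with orthonormal rows, i.e. $\mathbf{W}_1^h(\mathbf{W}_1^h)^{\top}=\mathbf{I}_{m_1}$ for all $h$. Define $F:\mathcal{S}^m_+\to\mathcal{S}^{m_1}_+$ by $$F(\mathbf{X})=\exp\Big(\frac{1}{H}\sum_{h=1}^H \log\big(\mathbf{W}_1^h\mathbf{X}(\mathbf{W}_1^h)^{\top}\big)\Big),$$ i.e. $F(\mathbf{X})$ is the Log-Euclidean Fréchet mean of $\mathbf{W}_1^1\mathbf{X}(\mathbf{W}_1^1)^{\top},\ldots,\mathbf{W}_1^H\mathbf{X}(\mathbf{W}_1^H)^{\top}$. Fix any $0<\alpha\le\beta<\infty$ and let $\mathcal{X}_{\alpha,\beta}=\{\mathbf{X}\in\mathcal{S}^m_+:\alpha\mathbf{I}\preceq\mathbf{X}\preceq\beta\mathbf{I}\}$. Then $F$ is Lipschitz on $\mathcal{X}_{\alpha,\beta}$ with respect to the Log-Euclidean distances, with constant $L\le\beta/\alpha$: $$d_{\mathrm{LE}}(F(\mathbf{X}),F(\mathbf{Z}))\le\frac{\beta}{\alpha}\,d_{\mathrm{LE}}(\mathbf{X},\mathbf{Z})\qquad\text{for all }\mathbf{X},\mathbf{Z}\in\mathcal{X}_{\alpha,\beta}.$$ Moreover, the map $F:\mathcal{S}^m_+\to\mathcal{S}^{m_1}_+$ is neither contractive nor non-expansive with respect to the Log-Euclidean dis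tances.
   Context: $\mathcal{S}^n_+$ denotes the set of real symmetric positive definite $n\times n$ matrices. $\log$ is the principal matrix logarithm on $\mathcal{S}^n_+$ and $\exp$ the matrix exponential on real symmetric matrices. $\preceq$ is the Loewner order. The Log-Euclidean distance on $\mathcal{S}^n_+$ is $d_{\mathrm{LE}}(\mathbf{X},\mathbf{Z})=\|\log(\mathbf{X})-\log(\mathbf{Z})\|_F$ with $\|\cdot\|_F$ the Frobenius norm; the Log-Euclidean Fréchet mean of $\mathbf{X}_1,\ldots,\mathbf{X}_H$ is the unique minimizer over $\mathbf{X}$ of $\sum_h d_{\mathrm{LE}}(\mathbf{X},\mathbf{X}_h)^2$, which equals $\exp(\frac1H\sum_h\log(\mathbf{X}_h))$. A map $F$ between metric spaces is non-expansive if $d(F(x),F(y))\le d(x,y)$ for all $x,y$, and contractive if there is a constant $c<1$ with $d(F(x),F(y))\le c\,d(x,y)$ for all $x,y$. *)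

theory Defs
  imports "HOL-Analysis.Analysis"
begin

definition symmetric_mat :: "real^'n^'n \<Rightarrow> bool" where
  "symmetric_mat A \<longleftrightarrow> transpose A = A"

definition spd :: "(real^'n^'n) set" where
  "spd = {A. symmetric_mat A \<and> (\<forall>v. v \<noteq> 0 \<longrightarrow> 0 < v \<bullet> (A *v v))}"

definition psd :: "(real^'n^'n) set" where
  "psd = {A. symmetric_mat A \<and> (\<forall>v. 0 \<le> v \<bullet> (A *v v))}"

definition loewner_le :: "real^'n^'n \<Rightarrow> real^'n^'n \<Rightarrow> bool" (infix "\<preceq>" 50) where
  "A \<preceq> B \<longleftrightarrow> B - A \<in> psd"

(* The type class multiplication and power on real^'n^'n act entrywise, so powers with
   respect to the matrix product are defined separately. *)
definition mat_pow :: "real^'n^'n \<Rightarrow> nat \<Rightarrow> real^'n^'n" where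
  "mat_pow A k = ((\<lambda>B. A ** B) ^^ k) (mat 1)"

definition mat_exp :: "real^'n^'n \<Rightarrow> real^'n^'n" where
  "mat_exp A = (\<Sum>k. mat_pow A k /\<^sub>R fact k)"

definition complex_eigenvalue :: "real^'n^'n \<Rightarrow> complex \<Rightarrow> bool" where
  "complex_eigenvalue A \<mu> \<longleftrightarrow>
     (\<exists>v :: complex^'n. v \<noteq> 0 \<and> map_matrix complex_of_real A *v v = \<mu> *s v)"

(* The principal logarithm is the unique logarithm whose spectrum lies in the open strip
   |Im z| < pi. A real matrix without eigenvalues in (-infinity, 0] has a real principal
   logarithm, so it suffices to range over real L. The value is unspecified on matrices
   that have no principal logarithm. *)
definition mat_log :: "real^'n^'n \<Rightarrow> real^'n^'n" where
  "mat_log A = (THE L. mat_exp L = A \<and> (\<forall>\<mu>. complex_eigenvalue L \<mu> \<longrightarrow> \<bar>Im \<mu>\<bar> < pi))"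

(* The library norm on real^'n^'m is the Frobenius norm. *)
lemma norm_eq_frobenius:
  fixes A :: "real^'n^'m"
  shows "norm A = sqrt (\<Sum>i\<in>UNIV. \<Sum>j\<in>UNIV. (A $ i $ j)\<^sup>2)"
  by (simp add: norm_vec_def L2_set_def sum_nonneg)

definition dist_LE :: "real^'n^'n \<Rightarrow> real^'n^'n \<Rightarrow> real" where
  "dist_LE X Z = norm (mat_log X - mat_log Z)"

definition is_LE_frechet_mean :: "nat \<Rightarrow> (nat \<Rightarrow> real^'n^'n) \<Rightarrow> real^'n^'n \<Rightarrow> bool" where
  "is_LE_frechet_mean H Y M \<longleftrightarrow>
     M \<in> spd \<and>
     (\<forall>X\<in>spd. X \<noteq> M \<longrightarrow> (\<Sum>h=1..H. (dist_LE M (Y h))\<^sup>2) < (\<Sum>h=1..H. (dist_LE X (Y h))\<^sup>2))"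

definition LE_mean_map ::
    "nat \<Rightarrow> (nat \<Rightarrow> real^'m^'k) \<Rightarrow> real^'m^'m \<Rightarrow> real^'k^'k" where
  "LE_mean_map H W X =
     mat_exp ((1 / real H) *\<^sub>R (\<Sum>h=1..H. mat_log (W h ** X ** transpose (W h))))"

definition spd_between :: "real \<Rightarrow> real \<Rightarrow> (real^'n^'n) set" where
  "spd_between \<alpha> \<beta> = {X \<in> spd. mat \<alpha> \<preceq> X \<and> X \<preceq> mat \<beta>}"

definition nonexpansive_map ::
    "'a set \<Rightarrow> ('a \<Rightarrow> 'a \<Rightarrow> real) \<Rightarrow> ('b \<Rightarrow> 'b \<Rightarrow> real) \<Rightarrow> ('a \<Rightarrow> 'b) \<Rightarrow> bool" where
  "nonexpansive_map S d d' f \<longleftrightarrow> (\<forall>x\<in>S. \<forall>y\<in>S. d' (f x) (f y) \<le> d x y)"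

definition contractive_map ::
    "'a set \<Rightarrow> ('a \<Rightarrow> 'a \<Rightarrow> real) \<Rightarrow> ('b \<Rightarrow> 'b \<Rightarrow> real) \<Rightarrow> ('a \<Rightarrow> 'b) \<Rightarrow> bool" where
  "contractive_map S d d' f \<longleftrightarrow> (\<exists>c<1. \<forall>x\<in>S. \<forall>y\<in>S. d' (f x) (f y) \<le> c * d x y)"

end

theory Submission
  imports Defs "HOL-Computational_Algebra.Fundamental_Theorem_Algebra"
begin

text \<open>Write symmetric matrices \<open>A\<close> and \<open>B\<close> in orthonormal eigenbases \<open>u\<close> and \<open>w\<close> with eigenvalues \<open>l\<close>
  and \<open>m\<close>. Then \<open>f(A) - f(B)\<close> has the entries \<open>(f (l i) - f (m j)) * (u i \<bullet> w j)\<close>, so the scalar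
  estimates \<open>\<bar>ln s - ln t\<bar> \<le> \<bar>s - t\<bar> / \<alpha>\<close> for \<open>s, t \<ge> \<alpha>\<close> and \<open>\<bar>s - t\<bar> \<le> \<beta> * \<bar>ln s - ln t\<bar>\<close> for
  \<open>s, t \<le> \<beta>\<close> carry over to the Frobenius norm. Compression by a matrix with orthonormal rows
  preserves Loewner bounds and does not increase the Frobenius norm, which gives the constant
  \<open>\<beta> / \<alpha>\<close>.

  On all of \<open>spd\<close> the map is not Lipschitz for any constant. Let \<open>X\<^sub>v = exp (- t v v\<^sup>T)\<close>. If the unit
  vector \<open>v\<close> lies in the row space of \<open>W 1\<close>, then \<open>log F(X\<^sub>v)\<close> has a quadratic form value at most
  \<open>- t / H\<close>. If \<open>v'\<close> lies outside all row spaces, then \<open>log F(X\<^sub>v\<^sub>')\<close> stays bounded below as \<open>t\<close> grows.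
  Such \<open>v'\<close> exist arbitrarily close to \<open>v\<close>, where the distance of \<open>X\<^sub>v\<close> and \<open>X\<^sub>v\<^sub>'\<close> is a small multiple
  of \<open>t\<close>.\<close>

subsection \<open>The spectral theorem for real symmetric matrices\<close>

text \<open>The quadratic form \<open>x \<bullet> f x\<close> attains its maximum on the compact
  unit sphere of \<open>S\<close>. A maximiser is an eigenvector because the first-order variation
  there vanishes.\<close>

lemma selfadjoint_max_eigenvector:
  fixes f :: "'a::euclidean_space \<Rightarrow> 'a"
  assumes lin: "linear f" and sa: "\<And>x y. f x \<bullet> y = x \<bullet> f y"
    and S: "subspace S" and inv: "\<And>x. x \<in> S \<Longrightarrow> f x \<in> S" and nt: "S \<noteq> {0}"
  obtains x l where "x \<in> S" "norm x = 1" "f x = l *\<^sub>R x"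
proof -
  let ?K = "S \<inter> sphere 0 1"
  have cpt: "compact ?K" using closed_subspace[OF S] by (simp add: closed_Int_compact)
  obtain z where z: "z \<in> S" "z \<noteq> 0" using nt subspace_0[OF S] by auto
  have "(1 / norm z) *\<^sub>R z \<in> ?K" using z subspace_scale[OF S] by simp
  then have ne: "?K \<noteq> {}" by blast
  have cont: "continuous_on ?K (\<lambda>x. x \<bullet> f x)"
    by (intro continuous_intros linear_continuous_on_compose[OF _ lin])
  obtain x where x: "x \<in> ?K" and max: "\<And>y. y \<in> ?K \<Longrightarrow> y \<bullet> f y \<le> x \<bullet> f x"
    using continuous_attains_sup[OF cpt ne cont] by blast
  define M where "M = x \<bullet> f x"
  have q: "0 \<le> M * (y \<bullet> y) - y \<bullet> f y" if "y \<in> S" for y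
  proof (cases "y = 0")
    case True then show ?thesis by (simp add: linear_0[OF lin])
  next
    case False
    let ?y = "(1 / norm y) *\<^sub>R y"
    have "?y \<in> ?K" using that False subspace_scale[OF S] by simp
    from max[OF this] have "(y \<bullet> f y) / (norm y)^2 \<le> M"
      by (simp add: M_def linear_scale[OF lin] power2_eq_square)
    then show ?thesis using False by (simp add: field_simps power2_norm_eq_inner)
  qed
  \<comment> \<open>\<open>y\<close> measures how far the maximiser \<open>x\<close> is from being
    an eigenvector for \<open>M\<close>; varying \<open>x\<close> in this very direction shows that
    it vanishes.\<close>
  define y where "y = M *\<^sub>R x - f x"
  have xS: "x \<in> S" "x \<bullet> x = 1" using x by (auto simp: dot_square_norm)
  have yS: "y \<in> S" unfolding y_def using xS inv subspace_scale[OF S] subspace_diff[OF S] by blast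
  have yy: "y \<bullet> y = M * (x \<bullet> y) - f x \<bullet> y" by (simp add: y_def algebra_simps)
  define c where "c = M * (y \<bullet> y) - y \<bullet> f y"
  have c0: "0 \<le> c" unfolding c_def using q[OF yS] .
  \<comment> \<open>The form \<open>M |z|\<^sup>2 - z \<bullet> f z\<close> is nonnegative and vanishes at \<open>x\<close>, so its linear term at \<open>x\<close> vanishes.\<close>
  have quad: "0 \<le> 2 * e * (y \<bullet> y) + e^2 * c" for e
  proof -
    have "x + e *\<^sub>R y \<in> S" using xS yS subspace_scale[OF S] subspace_add[OF S] by blast
    from q[OF this] have "0 \<le> M * ((x + e *\<^sub>R y) \<bullet> (x + e *\<^sub>R y)) - (x + e *\<^sub>R y) \<bullet> f (x + e *\<^sub>R y)" .
    also have "\<dots> = 2 * e * (M * (x \<bullet> y) - f x \<bullet> y) + e^2 * c"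
      unfolding c_def
      using xS sa[of x y] inner_commute[of y "f x"]
      by (simp add: linear_add[OF lin] linear_scale[OF lin] inner_add inner_commute[of y x] M_def[symmetric] power2_eq_square algebra_simps)
    also have "\<dots> = 2 * e * (y \<bullet> y) + e^2 * c" by (simp only: yy)
    finally show ?thesis .
  qed
  have "y \<bullet> y \<le> 0"
  proof (rule ccontr)
    assume "\<not> y \<bullet> y \<le> 0"
    then have p: "0 < y \<bullet> y" by (simp only: not_le)
    \<comment> \<open>For this \<open>e\<close> the right-hand side of \<open>quad\<close> becomes
      \<open>e * (y \<bullet> y) - e^2\<close>, which is negative; \<open>c + 1\<close> in place of
      \<open>c\<close> keeps the denominator nonzero.\<close>
    define e where "e = - (y \<bullet> y) / (c + 1)"
    have e: "e * (c + 1) = - (y \<bullet> y)" "e < 0" using c0 p by (auto simp: e_def divide_neg_pos)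
    have "0 \<le> 2 * e * (y \<bullet> y) + e * (e * (c + 1)) - e^2"
      using quad[of e] by (simp add: power2_eq_square algebra_simps)
    also have "\<dots> = e * (y \<bullet> y) - e^2" by (simp add: e(1))
    also have "\<dots> < 0" using mult_neg_pos[OF e(2) p] zero_le_power2[of e] by linarith
    finally show False by simp
  qed
  then have "y = 0" by (metis inner_ge_zero inner_eq_zero_iff order_antisym)
  then have "f x = M *\<^sub>R x" by (simp add: y_def)
  then show thesis using that[of x M] x by auto
qed

text \<open>Induction on the dimension: split off one eigenvector \<open>x\<close>. Self-adjointness
  keeps its orthogonal complement \<open>T\<close> inside \<open>S\<close> invariant.\<close>

lemma selfadjoint_eigenbasis_subspace:
  fixes f :: "'a::euclidean_space \<Rightarrow> 'a"
  assumes lin: "linear f" and sa: "\<And>x y. f x \<bullet> y = x \<bullet> f y"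
    and "subspace S" and "\<And>x. x \<in> S \<Longrightarrow> f x \<in> S"
  shows "\<exists>B. B \<subseteq> S \<and> span B = S \<and> pairwise orthogonal B \<and>
           (\<forall>b\<in>B. norm b = 1 \<and> (\<exists>l. f b = l *\<^sub>R b))"
  using assms(3,4)
proof (induction "dim S" arbitrary: S rule: less_induct)
  case less
  show ?case
  proof (cases "S = {0}")
    case True
    then show ?thesis by (intro exI[of _ "{}"]) auto
  next
    case False
    obtain x l where x: "x \<in> S" "norm x = 1" "f x = l *\<^sub>R x"
      using selfadjoint_max_eigenvector[OF lin sa less.prems False] by blast
    have xx: "x \<bullet> x = 1" using x(2) by (simp add: dot_square_norm)
    define T where "T = {y \<in> S. x \<bullet> y = 0}"
    have T: "subspace T" unfolding T_def
      using less.prems(1) by (auto simp: subspace_def inner_add_right)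
    have Tinv: "f y \<in> T" if "y \<in> T" for y
      using that less.prems(2) sa[of x y] by (auto simp: T_def x(3))
    have "x \<notin> T" using xx by (simp add: T_def)
    then have "T \<subset> S" using x(1) unfolding T_def by blast
    then have "dim T < dim S"
      by (metis T dim_psubset less.prems(1) span_eq_iff)
    from less.hyps[OF this T Tinv] obtain B where B: "B \<subseteq> T" "span B = T" "pairwise orthogonal B"
      "\<forall>b\<in>B. norm b = 1 \<and> (\<exists>l. f b = l *\<^sub>R b)" by blast
    have "span (insert x B) = S"
    proof
      show "span (insert x B) \<subseteq> S"
        using B(1) x(1) less.prems(1) by (intro span_minimal) (auto simp: T_def)
      show "S \<subseteq> span (insert x B)"
      proof
        fix y assume y: "y \<in> S"
        have "y - (x \<bullet> y) *\<^sub>R x \<in> T"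
          using y x less.prems(1) xx by (auto simp: T_def inner_diff_right intro!: subspace_diff subspace_scale)
        then show "y \<in> span (insert x B)" unfolding span_insert B(2) by blast
      qed
    qed
    moreover have "pairwise orthogonal (insert x B)"
      using B(1,3) unfolding pairwise_insert by (auto simp: T_def orthogonal_def inner_commute)
    ultimately show ?thesis
      using B x \<open>T \<subset> S\<close> by (intro exI[of _ "insert x B"]) auto
  qed
qed

text \<open>The family is indexed by the coordinate type \<open>'n\<close> itself, so orthonormality
  alone makes it a basis.\<close>

definition orthonormal_family :: "('n \<Rightarrow> real^'n) \<Rightarrow> bool" where
  "orthonormal_family u \<longleftrightarrow> (\<forall>i j. u i \<bullet> u j = (if i = j then 1 else 0))"

text \<open>A spectral decomposition as data: \<open>u\<close> and \<open>l\<close> determine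
  \<open>A\<close>, and a function of \<open>A\<close> is described by changing \<open>l\<close>
  only.\<close>

definition eigensystem :: "real^'n^'n \<Rightarrow> ('n \<Rightarrow> real^'n) \<Rightarrow> ('n \<Rightarrow> real) \<Rightarrow> bool" where
  "eigensystem A u l \<longleftrightarrow>
     orthonormal_family u \<and> (\<forall>i. A *v u i = l i *\<^sub>R u i)"

lemma symmetric_mat_inner:
  assumes "symmetric_mat A"
  shows "(A *v x) \<bullet> y = x \<bullet> (A *v y)"
  using assms unfolding symmetric_mat_def
  by (metis dot_lmul_matrix transpose_matrix_vector)

lemma symmetric_matI:
  assumes "\<And>x y. (A *v x) \<bullet> y = x \<bullet> (A *v y)"
  shows "symmetric_mat A"
proof -
  have "transpose A *v x = A *v x" for x
    by (rule vector_eq_ldot[THEN iffD1])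
      (metis assms dot_lmul_matrix inner_commute transpose_matrix_vector)
  then show ?thesis unfolding symmetric_mat_def by (simp add: matrix_eq)
qed

theorem symmetric_mat_eigensystem:
  fixes A :: "real^'n^'n"
  assumes "symmetric_mat A"
  obtains u l where "eigensystem A u l"
proof -
  have lin: "linear ((*v) A)" by simp
  have "\<exists>B. B \<subseteq> UNIV \<and> span B = UNIV \<and> pairwise orthogonal B \<and>
      (\<forall>b\<in>B. norm b = 1 \<and> (\<exists>l. A *v b = l *\<^sub>R b))"
    by (rule selfadjoint_eigenbasis_subspace[OF lin]) (auto simp: symmetric_mat_inner[OF assms])
  then obtain B where B: "span B = UNIV" "pairwise orthogonal B"
    "\<forall>b\<in>B. norm b = 1 \<and> (\<exists>l. A *v b = l *\<^sub>R b)" by blast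
  have "0 \<notin> B" using B(3) by force
  then have ind: "independent B" using B(2) pairwise_orthogonal_independent by blast
  then have "finite B" "card B = CARD('n)"
    using independent_bound[OF ind] dim_eq_card_independent[OF ind] dim_span[of B] B(1) by auto
  \<comment> \<open>The eigenbasis has as many elements as \<open>'n\<close>, so it can be indexed
    by this type.\<close>
  then obtain u where u: "bij_betw u (UNIV :: 'n set) B"
    using finite_same_card_bij[of "UNIV :: 'n set" B] by auto
  have uB: "u i \<in> B" for i using u bij_betwE by blast
  have "\<forall>i. \<exists>l. A *v u i = l *\<^sub>R u i" using B(3) uB by blast
  then obtain l where l: "\<And>i. A *v u i = l i *\<^sub>R u i" by metis
  have "u i \<bullet> u j = (if i = j then 1 else 0)" for i j
  proof (cases "i = j")
    case True then show ?thesis using B(3) uB by (simp add: dot_square_norm)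
  next
    case False
    then have "u i \<noteq> u j" using u by (auto simp: bij_betw_def inj_on_def)
    then show ?thesis using B(2) uB False by (auto simp: pairwise_def orthogonal_def)
  qed
  then show thesis using l that unfolding eigensystem_def orthonormal_family_def by blast
qed

subsection \<open>Eigensystems and the matrix exponential\<close>

text \<open>By counting, the family spans the space. The remainder \<open>d\<close> of the expansion
  is orthogonal to every member, hence to itself.\<close>

lemma orthonormal_family_expand:
  fixes u :: "'n::finite \<Rightarrow> real^'n"
  assumes "orthonormal_family u"
  shows "(\<Sum>i\<in>UNIV. (u i \<bullet> x) *\<^sub>R u i) = x"
proof -
  have u: "u i \<bullet> u j = (if i = j then 1 else 0)" for i j
    using assms by (simp add: orthonormal_family_def)
  have inj: "inj u" by (rule injI) (metis u zero_neq_one)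
  have "pairwise orthogonal (range u)"
    using u by (auto simp: pairwise_def orthogonal_def)
  moreover have "0 \<notin> range u" by (metis imageE inner_zero_left u zero_neq_one)
  ultimately have ind: "independent (range u)" by (rule pairwise_orthogonal_independent)
  have "card (range u) = CARD('n)" using inj by (simp add: card_image)
  then have span: "span (range u) = UNIV"
    using card_ge_dim_independent[of "range u" UNIV] ind by auto
  define d where "d = x - (\<Sum>i\<in>UNIV. (u i \<bullet> x) *\<^sub>R u i)"
  have d: "u j \<bullet> d = 0" for j
    by (simp add: d_def inner_diff_right inner_sum_right u if_distrib cong: if_cong)
  have "orthogonal d y" if "y \<in> span (range u)" for y
    by (rule orthogonal_to_span[OF that]) (auto simp: orthogonal_def inner_commute[of d] d)
  then have "orthogonal d d" using span by blast
  then show ?thesis by (simp add: d_def orthogonal_def)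
qed

lemma orthonormal_family_inner:
  fixes u :: "'n::finite \<Rightarrow> real^'n"
  assumes "orthonormal_family u"
  shows "x \<bullet> y = (\<Sum>i\<in>UNIV. (u i \<bullet> x) * (u i \<bullet> y))"
  using arg_cong[OF orthonormal_family_expand[OF assms, of x], of "\<lambda>z. z \<bullet> y"]
  by (simp add: inner_sum_left)

lemma eigensystem_orthonormal: "eigensystem A u l \<Longrightarrow> orthonormal_family u"
  by (simp add: eigensystem_def)

lemma eigensystem_apply:
  assumes "eigensystem A u l"
  shows "A *v x = (\<Sum>i\<in>UNIV. (l i * (u i \<bullet> x)) *\<^sub>R u i)"
proof -
  have "A *v x = A *v (\<Sum>i\<in>UNIV. (u i \<bullet> x) *\<^sub>R u i)"
    by (simp add: orthonormal_family_expand[OF eigensystem_orthonormal[OF assms]])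
  also have "\<dots> = (\<Sum>i\<in>UNIV. (u i \<bullet> x) *\<^sub>R (A *v u i))"
    by (simp add: linear_sum[OF matrix_vector_mul_linear] matrix_vector_mult_scaleR)
  finally show ?thesis using assms by (simp add: eigensystem_def mult.commute)
qed

lemma eigensystem_inner:
  assumes "eigensystem A u l"
  shows "x \<bullet> (A *v y) = (\<Sum>i\<in>UNIV. l i * (u i \<bullet> x) * (u i \<bullet> y))"
  unfolding eigensystem_apply[OF assms]
  by (simp add: inner_sum_right inner_commute[of x] mult_ac)

lemma eigensystem_symmetric: "eigensystem A u l \<Longrightarrow> symmetric_mat A"
  by (rule symmetric_matI) (simp add: inner_commute[of "A *v _"] eigensystem_inner mult_ac)

lemma eigensystem_unique: "eigensystem A u l \<Longrightarrow> eigensystem B u l \<Longrightarrow> A = B"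
  by (simp add: matrix_eq eigensystem_apply)

lemma eigensystem_eigenvalue: "eigensystem A u l \<Longrightarrow> u i \<bullet> (A *v u i) = l i"
  by (simp add: eigensystem_def orthonormal_family_def)

lemma eigensystem_ge:
  assumes "eigensystem A u l" "\<And>i. c \<le> l i"
  shows "c * (x \<bullet> x) \<le> x \<bullet> (A *v x)"
  unfolding eigensystem_inner[OF assms(1)]
    orthonormal_family_inner[OF eigensystem_orthonormal[OF assms(1)], of x x]
  unfolding sum_distrib_left mult.assoc
  by (intro sum_mono mult_right_mono assms(2)) auto

lemma eigensystem_le:
  assumes "eigensystem A u l" "\<And>i. l i \<le> c"
  shows "x \<bullet> (A *v x) \<le> c * (x \<bullet> x)"
  unfolding eigensystem_inner[OF assms(1)]
    orthonormal_family_inner[OF eigensystem_orthonormal[OF assms(1)], of x x]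
  unfolding sum_distrib_left mult.assoc
  by (intro sum_mono mult_right_mono assms(2)) auto

lemma spd_eigensystem:
  fixes A :: "real^'n^'n"
  assumes "A \<in> spd"
  obtains u l where "eigensystem A u l" "\<And>i. 0 < l i"
proof -
  obtain u l where e: "eigensystem A u l"
    using assms symmetric_mat_eigensystem unfolding spd_def by blast
  have "0 < l i" for i
  proof -
    have "u i \<bullet> u i = 1" using e by (simp add: eigensystem_def orthonormal_family_def)
    then have "u i \<noteq> 0" by auto
    then show ?thesis
      using assms eigensystem_eigenvalue[OF e, of i] unfolding spd_def by auto
  qed
  with e show thesis by (rule that)
qed

lemma eigensystem_spd:
  fixes A :: "real^'n^'n"
  assumes e: "eigensystem A u l" and pos: "\<And>i. 0 < l i"
  shows "A \<in> spd"
proof -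
  \<comment> \<open>The least eigenvalue; it is positive because the index type is finite.\<close>
  define c where "c = Min (range l)"
  have c: "0 < c" "\<And>i. c \<le> l i" using pos by (auto simp: c_def)
  have "0 < v \<bullet> (A *v v)" if "v \<noteq> 0" for v
  proof -
    have "0 < c * (v \<bullet> v)" using c that by simp
    also have "\<dots> \<le> v \<bullet> (A *v v)" by (rule eigensystem_ge[OF e c(2)])
    finally show ?thesis .
  qed
  then show ?thesis using eigensystem_symmetric[OF e] by (simp add: spd_def)
qed

section \<open>The Frobenius norm in orthonormal bases\<close>

text \<open>Parseval is applied twice: to the rows of \<open>M\<close> in the basis
  \<open>w\<close>, then to the vectors \<open>M *v w j\<close> in the basis
  \<open>u\<close>.\<close>

lemma norm_eq_sum_inner_orthonormal:
  fixes M :: "real^'n^'n"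
  assumes u: "orthonormal_family u" and w: "orthonormal_family w"
  shows "(norm M)\<^sup>2 = (\<Sum>i\<in>UNIV. \<Sum>j\<in>UNIV. (u i \<bullet> (M *v w j))\<^sup>2)"
proof -
  have "(norm M)\<^sup>2 = (\<Sum>k\<in>UNIV. M $ k \<bullet> M $ k)"
    by (simp add: power2_norm_eq_inner inner_vec_def)
  also have "\<dots> = (\<Sum>k\<in>UNIV. \<Sum>j\<in>UNIV. ((M *v w j) $ k)\<^sup>2)"
    by (intro sum.cong refl, subst orthonormal_family_inner[OF w])
      (simp add: matrix_vector_mul_component inner_commute power2_eq_square)
  also have "\<dots> = (\<Sum>j\<in>UNIV. \<Sum>k\<in>UNIV. ((M *v w j) $ k)\<^sup>2)" by (rule sum.swap)
  also have "\<dots> = (\<Sum>j\<in>UNIV. (M *v w j) \<bullet> (M *v w j))"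
    by (simp add: inner_vec_def power2_eq_square)
  also have "\<dots> = (\<Sum>j\<in>UNIV. \<Sum>i\<in>UNIV. (u i \<bullet> (M *v w j))\<^sup>2)"
    by (intro sum.cong refl, subst orthonormal_family_inner[OF u]) (simp add: power2_eq_square)
  also have "\<dots> = (\<Sum>i\<in>UNIV. \<Sum>j\<in>UNIV. (u i \<bullet> (M *v w j))\<^sup>2)" by (rule sum.swap)
  finally show ?thesis .
qed

text \<open>Both squared norms are sums with the same weights
  \<open>(u i \<bullet> w j)\<^sup>2\<close>, so a scalar estimate between eigenvalues suffices.
  Using two eigenbases at once covers matrices that do not commute.\<close>

lemma norm_diff_le_eigensystem:
  fixes A B :: "real^'n^'n"
  assumes A: "eigensystem A u l" and B: "eigensystem B w m"
    and A': "eigensystem A' u l'" and B': "eigensystem B' w m'"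
    and le: "\<And>i j. \<bar>l' i - m' j\<bar> \<le> K * \<bar>l i - m j\<bar>" and K: "0 \<le> K"
  shows "norm (A' - B') \<le> K * norm (A - B)"
proof -
  note u = eigensystem_orthonormal[OF A] and w = eigensystem_orthonormal[OF B]
  \<comment> \<open>Letting \<open>C\<close> act on the left vector and \<open>D\<close> on the
    right one turns both into eigenvalues.\<close>
  have entry: "u i \<bullet> ((C - D) *v w j) = (p i - q j) * (u i \<bullet> w j)"
    if C: "eigensystem C u p" and D: "eigensystem D w q" for C D p q i j
  proof -
    have "u i \<bullet> (C *v w j) = (C *v u i) \<bullet> w j"
      using symmetric_mat_inner[OF eigensystem_symmetric[OF C]] by simp
    then have "u i \<bullet> (C *v w j) = p i * (u i \<bullet> w j)" using C by (simp add: eigensystem_def)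
    moreover have "u i \<bullet> (D *v w j) = q j * (u i \<bullet> w j)" using D by (simp add: eigensystem_def)
    ultimately show ?thesis
      by (simp add: matrix_vector_mult_diff_rdistrib inner_diff_right left_diff_distrib)
  qed
  have "(norm (A' - B'))\<^sup>2 = (\<Sum>i\<in>UNIV. \<Sum>j\<in>UNIV. ((l' i - m' j) * (u i \<bullet> w j))\<^sup>2)"
    unfolding norm_eq_sum_inner_orthonormal[OF u w] entry[OF A' B'] ..
  also have "\<dots> \<le> (\<Sum>i\<in>UNIV. \<Sum>j\<in>UNIV. (K * ((l i - m j) * (u i \<bullet> w j)))\<^sup>2)"
  proof (intro sum_mono)
    fix i j
    have "\<bar>(l' i - m' j) * (u i \<bullet> w j)\<bar> \<le> \<bar>K * ((l i - m j) * (u i \<bullet> w j))\<bar>"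
      using mult_right_mono[OF le[of i j] abs_ge_zero[of "u i \<bullet> w j"]] K
      unfolding abs_mult mult.assoc by (simp only: abs_of_nonneg)
    then show "((l' i - m' j) * (u i \<bullet> w j))\<^sup>2 \<le> (K * ((l i - m j) * (u i \<bullet> w j)))\<^sup>2"
      by (simp only: abs_le_square_iff[symmetric])
  qed
  also have "\<dots> = (K * norm (A - B))\<^sup>2"
    unfolding power_mult_distrib[of K] norm_eq_sum_inner_orthonormal[OF u w] entry[OF A B] sum_distrib_left ..
  finally show ?thesis using K by (intro power2_le_imp_le[of "norm (A' - B')"]) auto
qed

lemma norm_matrix_vector_mult_le:
  fixes A :: "real^'n^'m"
  shows "norm (A *v x) \<le> norm A * norm x"
proof -
  have "norm (A *v x) \<le> L2_set (\<lambda>i. norm (A $ i) * norm x) UNIV"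
    unfolding norm_vec_def[of "A *v x"]
    by (intro L2_set_mono) (auto simp: matrix_vector_mul_component Cauchy_Schwarz_ineq2)
  also have "\<dots> = norm A * norm x"
    by (simp add: norm_vec_def[of A] L2_set_left_distrib[symmetric])
  finally show ?thesis .
qed

lemma norm_transpose [simp]:
  fixes A :: "real^'n^'m"
  shows "norm (transpose A) = norm A"
  unfolding norm_eq_frobenius
  by (subst sum.swap) (simp add: transpose_def)

text \<open>The rows of \<open>A ** B\<close> are \<open>transpose B\<close> applied to the rows of
  \<open>A\<close>, which reduces the bound to matrix-vector products.\<close>

lemma norm_matrix_mult_le:
  fixes A :: "real^'n^'m" and B :: "real^'p^'n"
  shows "norm (A ** B) \<le> norm A * norm B"
proof -
  have row: "(A ** B) $ i = transpose B *v (A $ i)" for i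
    by (simp add: vec_eq_iff matrix_matrix_mult_def matrix_vector_mult_def transpose_def mult.commute)
  have "norm (A ** B) \<le> L2_set (\<lambda>i. norm (A $ i) * norm B) UNIV"
    unfolding norm_vec_def[of "A ** B"] row
    using norm_matrix_vector_mult_le[of "transpose B"] by (intro L2_set_mono) (auto simp: mult.commute[of "norm (A $ _)"])
  also have "\<dots> = norm A * norm B"
    by (simp add: norm_vec_def[of A] L2_set_left_distrib[symmetric])
  finally show ?thesis .
qed

section \<open>The power series of the matrix exponential\<close>

lemma mat_pow_0 [simp]: "mat_pow A 0 = mat 1"
  and mat_pow_Suc [simp]: "mat_pow A (Suc k) = A ** mat_pow A k"
  by (simp_all add: mat_pow_def)

lemma mat_pow_commute: "A ** mat_pow A k = mat_pow A k ** A"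
proof (induction k)
  case (Suc k)
  then show ?case by (metis mat_pow_Suc matrix_mul_assoc)
qed simp

lemma norm_mat_pow_le:
  fixes A :: "real^'n^'n"
  shows "norm (mat_pow A k) \<le> norm A ^ k * norm (mat 1 :: real^'n^'n)"
proof (induction k)
  case (Suc k)
  have "norm (mat_pow A (Suc k)) \<le> norm A * norm (mat_pow A k)"
    using norm_matrix_mult_le by simp
  also have "\<dots> \<le> norm A * (norm A ^ k * norm (mat 1 :: real^'n^'n))"
    by (intro mult_left_mono Suc) simp
  finally show ?case by (simp add: mult_ac)
qed simp

text \<open>Comparison with the scalar exponential series at \<open>norm A\<close>. The factor
  \<open>norm (mat 1)\<close> appears because the Frobenius norm of the identity is not 1 in
  general.\<close>

lemma mat_exp_sums:
  fixes A :: "real^'n^'n"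
  shows "(\<lambda>k. mat_pow A k /\<^sub>R fact k) sums mat_exp A"
  unfolding mat_exp_def
proof (rule summable_sums, rule summable_comparison_test')
  show "summable (\<lambda>k. (norm A ^ k /\<^sub>R fact k) * norm (mat 1 :: real^'n^'n))"
    by (intro summable_mult2 summable_exp_generic)
  show "norm (mat_pow A k /\<^sub>R fact k) \<le> (norm A ^ k /\<^sub>R fact k) * norm (mat 1 :: real^'n^'n)" for k
    using norm_mat_pow_le[of A k] by (simp add: divide_simps)
qed

text \<open>Linear maps on a finite-dimensional space are bounded, so they pass through the series.
  Commutation with \<open>A\<close> and the action on eigenvectors then follow from statements about
  powers.\<close>

lemma linear_mat_exp_sums:
  fixes A :: "real^'n^'n" and f :: "real^'n^'n \<Rightarrow> 'b::real_normed_vector"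
  assumes "linear f"
  shows "(\<lambda>k. f (mat_pow A k) /\<^sub>R fact k) sums f (mat_exp A)"
  using bounded_linear.sums[OF linear_conv_bounded_linear[THEN iffD1, OF assms] mat_exp_sums[of A]]
  by (simp add: linear_scale[OF assms])

lemma matrix_add_rdistrib:
  fixes A B :: "real^'n^'m" and C :: "real^'p^'n"
  shows "(A + B) ** C = A ** C + B ** C"
  by (simp add: vec_eq_iff matrix_matrix_mult_def distrib_right sum.distrib)

lemma mat_exp_commute:
  fixes A :: "real^'n^'n"
  shows "A ** mat_exp A = mat_exp A ** A"
proof -
  have "linear (\<lambda>B. A ** B - B ** A)"
    by (rule linearI)
      (simp_all add: matrix_add_ldistrib matrix_add_rdistrib matrix_scalar_ac scalar_matrix_assoc scaleR_diff_right)
  from linear_mat_exp_sums[OF this, of A] have "(\<lambda>k. 0) sums (A ** mat_exp A - mat_exp A ** A)"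
    by (simp add: mat_pow_commute)
  then show ?thesis by (simp add: sums_iff)
qed

lemma mat_exp_eigenvector:
  fixes A :: "real^'n^'n"
  assumes "A *v v = l *\<^sub>R v"
  shows "mat_exp A *v v = exp l *\<^sub>R v"
proof -
  have "linear (\<lambda>B. B *v v)"
    by (rule linearI) (simp_all add: matrix_vector_mult_add_rdistrib scaleR_matrix_vector_assoc)
  note sums = linear_mat_exp_sums[OF this, of A]
  have "mat_pow A k *v v = l ^ k *\<^sub>R v" for k
    by (induction k) (simp_all add: assms matrix_vector_mult_scaleR mult.commute flip: matrix_vector_mul_assoc)
  then have "(\<lambda>k. (l ^ k /\<^sub>R fact k) *\<^sub>R v) sums (mat_exp A *v v)" using sums by simp
  moreover have "(\<lambda>k. (l ^ k /\<^sub>R fact k) *\<^sub>R v) sums (exp l *\<^sub>R v)"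
    by (intro sums_scaleR_left exp_converges)
  ultimately show ?thesis by (rule sums_unique2)
qed

lemma eigensystem_mat_exp: "eigensystem A u l \<Longrightarrow> eigensystem (mat_exp A) u (\<lambda>i. exp (l i))"
  by (simp add: eigensystem_def mat_exp_eigenvector)

lemma mat_exp_spd: "symmetric_mat A \<Longrightarrow> mat_exp A \<in> spd"
  by (metis eigensystem_mat_exp eigensystem_spd exp_gt_zero symmetric_mat_eigensystem)

subsection \<open>Uniqueness of the principal logarithm\<close>

definition complex_vec :: "real^'n \<Rightarrow> complex^'n" where
  "complex_vec x = (\<chi> i. complex_of_real (x $ i))"

abbreviation complex_mat :: "real^'n^'m \<Rightarrow> complex^'n^'m" where
  "complex_mat \<equiv> map_matrix complex_of_real"

lemma complex_mat_mult: "complex_mat (A ** B) = complex_mat A ** complex_mat B"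
  by (simp add: vec_eq_iff matrix_matrix_mult_def)

lemma complex_mat_1: "complex_mat (mat 1) = mat 1"
  by (simp add: vec_eq_iff mat_def)

lemma complex_mat_vec: "complex_mat A *v complex_vec x = complex_vec (A *v x)"
  by (simp add: vec_eq_iff matrix_vector_mult_def complex_vec_def)

lemma complex_vec_scaleR: "complex_vec (a *\<^sub>R x) = complex_of_real a *s complex_vec x"
  by (simp add: vec_eq_iff complex_vec_def)

lemma complex_vec_inject: "complex_vec x = complex_vec y \<longleftrightarrow> x = y"
  by (simp add: vec_eq_iff complex_vec_def)

lemma linear_complex_mat_vec: "linear (\<lambda>B. complex_mat B *v w)"
  by (rule linearI)
    (simp_all add: vec_eq_iff matrix_vector_mult_def distrib_right sum.distrib scaleR_sum_right scaleR_conv_of_real[where 'a = complex] sum_distrib_left mult.assoc)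

lemma bounded_linear_scalar_mult: "bounded_linear (\<lambda>z::complex. z *s (w::complex^'n))"
  by (rule linear_conv_bounded_linear[THEN iffD1], rule linearI) (simp_all add: vec_eq_iff algebra_simps)

lemma scaleR_scalar_mult: "r *\<^sub>R (z *s w) = (r *\<^sub>R z) *s (w :: complex^'n)"
  by (simp add: vec_eq_iff)

text \<open>\<open>w\<close> and \<open>y\<close> form a Jordan chain, degenerate if
  \<open>y = 0\<close>. Powers act on it through \<open>c ^ k\<close> and the derivative
  \<open>k * c ^ (k - 1)\<close>; both coefficient series sum to \<open>exp c\<close>.\<close>

lemma mat_exp_complex_jordan:
  fixes A :: "real^'n^'n"
  assumes w: "complex_mat A *v w = c *s w + y" and y: "complex_mat A *v y = c *s y"
  shows "complex_mat (mat_exp A) *v w = exp c *s (w + y)"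
proof -
  have pow: "complex_mat (mat_pow A k) *v w = c ^ k *s w + (of_nat k * c ^ (k - 1)) *s y" for k
  proof (induction k)
    case 0
    then show ?case by (simp add: complex_mat_1)
  next
    case (Suc k)
    have "complex_mat (mat_pow A (Suc k)) *v w = complex_mat A *v (c ^ k *s w + (of_nat k * c ^ (k - 1)) *s y)"
      by (simp add: complex_mat_mult Suc flip: matrix_vector_mul_assoc)
    also have "\<dots> = c ^ k *s (c *s w + y) + (of_nat k * c ^ (k - 1)) *s (c *s y)"
      by (simp add: vec.add vec.scale w y)
    also have "\<dots> = c ^ Suc k *s w + (of_nat (Suc k) * c ^ k) *s y"
      by (cases k) (simp_all add: vec_eq_iff algebra_simps)
    finally show ?case by simp
  qed
  have 1: "(\<lambda>k. (c ^ k /\<^sub>R fact k) *s w) sums (exp c *s w)"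
    by (intro bounded_linear.sums[OF bounded_linear_scalar_mult] exp_converges)
  have "(\<lambda>k. of_nat (Suc k) * c ^ k /\<^sub>R fact (Suc k)) sums exp c"
  proof -
    have "of_nat (Suc k) * c ^ k /\<^sub>R fact (Suc k) = c ^ k /\<^sub>R fact k" for k
      unfolding fact_Suc by (simp add: scaleR_conv_of_real del: of_nat_Suc)
    then show ?thesis using exp_converges[of c] by simp
  qed
  \<comment> \<open>The shift drops only the term at \<open>k = 0\<close>, where the factor
    \<open>of_nat k\<close> vanishes and the truncated exponent is harmless.\<close>
  then have "(\<lambda>k. of_nat k * c ^ (k - 1) /\<^sub>R fact k) sums exp c"
    using sums_Suc_iff[of "\<lambda>k. of_nat k * c ^ (k - 1) /\<^sub>R fact k" "exp c"] by (simp del: of_nat_Suc fact_Suc)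
  then have 2: "(\<lambda>k. (of_nat k * c ^ (k - 1) /\<^sub>R fact k) *s y) sums (exp c *s y)"
    by (intro bounded_linear.sums[OF bounded_linear_scalar_mult])
  have "(\<lambda>k. complex_mat (mat_pow A k) *v w /\<^sub>R fact k) sums (exp c *s w + exp c *s y)"
    using sums_add[OF 1 2] unfolding pow scaleR_add_right scaleR_scalar_mult .
  then show ?thesis
    using linear_mat_exp_sums[OF linear_complex_mat_vec, of A w] sums_unique2
    by (metis (no_types, lifting) vec.scale_right_distrib)
qed

lemma mat_exp_complex_eigenvector:
  fixes A :: "real^'n^'n"
  assumes "complex_mat A *v w = \<mu> *s w"
  shows "complex_mat (mat_exp A) *v w = exp \<mu> *s w"
  using mat_exp_complex_jordan[of A w \<mu> 0] assms by simp

section \<open>Polynomials in a matrix applied to a vector\<close>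

text \<open>This is \<open>p(M) w\<close> by Horner's scheme. Only vectors are accumulated, so the
  matrix \<open>p(M)\<close> is never formed.\<close>

definition poly_mat_vec :: "'a::field^'n^'n \<Rightarrow> 'a poly \<Rightarrow> 'a^'n \<Rightarrow> 'a^'n" where
  "poly_mat_vec M p w = fold_coeffs (\<lambda>a r. a *s w + M *v r) p 0"

lemma poly_mat_vec_0 [simp]: "poly_mat_vec M 0 w = 0"
  by (simp add: poly_mat_vec_def)

lemma poly_mat_vec_pCons [simp]:
  "poly_mat_vec M (pCons a p) w = a *s w + M *v poly_mat_vec M p w"
  by (cases "p = 0 \<and> a = 0") (auto simp: poly_mat_vec_def)

lemma poly_mat_vec_add: "poly_mat_vec M (p + q) w = poly_mat_vec M p w + poly_mat_vec M q w"
  by (induction p q rule: poly_induct2) (simp_all add: vec.add vec.scale_left_distrib)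

lemma poly_mat_vec_smult: "poly_mat_vec M (smult a p) w = a *s poly_mat_vec M p w"
  by (induction p) (simp_all add: vec.scale vec.scale_right_distrib)

text \<open>Polynomials in \<open>M\<close> commute, so the factor \<open>M - x\<close> may act on
  the vector first. This form lets an induction remove one root at a time.\<close>

lemma poly_mat_vec_linear_factor:
  "poly_mat_vec M ([:-x, 1:] * p) w = poly_mat_vec M p (M *v w - x *s w)"
proof -
  have "poly_mat_vec M ([:-x, 1:] * p) w = M *v poly_mat_vec M p w - x *s poly_mat_vec M p w"
  proof -
    have "[:-x, 1:] * p = pCons 0 p + smult (-x) p" by simp
    then show ?thesis by (simp only: poly_mat_vec_add poly_mat_vec_smult poly_mat_vec_pCons) simp
  qed
  also have "\<dots> = poly_mat_vec M p (M *v w - x *s w)"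
  proof (induction p)
    case (pCons a p)
    show ?case
      unfolding poly_mat_vec_pCons pCons.IH[symmetric] vec.add vec.scale vec.diff
      by (simp add: vec_eq_iff ring_distribs mult_ac)
  qed simp
  finally show ?thesis .
qed

lemma poly_mat_vec_monom: "poly_mat_vec M (monom a i) w = a *s (((*v) M ^^ i) w)"
  by (induction i) (simp_all add: monom_0 monom_Suc vec.scale)

lemma poly_mat_vec_sum: "poly_mat_vec M (\<Sum>i\<in>I. p i) w = (\<Sum>i\<in>I. poly_mat_vec M (p i) w)"
  by (induction I rule: infinite_finite_induct) (simp_all add: poly_mat_vec_add)

text \<open>The iterates of \<open>w\<close> under \<open>M\<close> with exponents from 0 to the
  dimension are one too many to be independent; a linear relation among them is the
  polynomial.\<close>

lemma annihilating_poly_exists: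
  fixes M :: "'a::field^'n^'n"
  obtains p where "p \<noteq> 0" "poly_mat_vec M p w = 0"
proof -
  define f where "f i = ((*v) M ^^ i) w" for i :: nat
  define N where "N = {..CARD('n)}"
  show thesis
  \<comment> \<open>Repeated iterates are treated apart: linear dependence concerns the image set,
    which would then be too small for the dimension count.\<close>
  proof (cases "inj_on f N")
    case False
    then obtain i j where ij: "i \<noteq> j" "f i = f j" by (auto simp: inj_on_def)
    have "poly_mat_vec M (monom 1 i + monom (-1) j) w = 0"
      using ij(2) by (simp add: poly_mat_vec_add poly_mat_vec_monom f_def)
    moreover have "coeff (monom 1 i + monom (-1 :: 'a) j) i \<noteq> 0" using ij(1) by simp
    then have "monom 1 i + monom (-1 :: 'a) j \<noteq> 0" by (metis coeff_0)
    ultimately show thesis using that by blast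
  next
    case True
    then have "card (f ` N) = Suc (CARD('n))" by (simp add: card_image N_def)
    moreover have "vec.dim (f ` N) \<le> CARD('n)"
      by (metis vec.dim_subset_UNIV vec_dim_card vec.dim_UNIV vec.dimension_def)
    ultimately have "vec.dependent (f ` N)"
      using vec.independent_card_le_dim[of "f ` N" "f ` N"] by auto
    then obtain c where c: "\<exists>v\<in>f ` N. c v \<noteq> 0" "(\<Sum>v\<in>f ` N. c v *s v) = 0"
      using vec.dependent_finite[of "f ` N"] by (auto simp: N_def)
    define p where "p = (\<Sum>i\<in>N. monom (c (f i)) i)"
    have "poly_mat_vec M p w = (\<Sum>i\<in>N. c (f i) *s f i)"
      by (simp add: p_def poly_mat_vec_sum poly_mat_vec_monom f_def)
    also have "\<dots> = 0" using c(2) by (simp add: sum.reindex[OF True])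
    finally have "poly_mat_vec M p w = 0" .
    moreover obtain i where i: "i \<in> N" "c (f i) \<noteq> 0" using c(1) by auto
    have "coeff p i = c (f i)" using i(1) by (simp add: p_def coeff_sum N_def)
    then have "p \<noteq> 0" using i(2) by auto
    ultimately show thesis using that by blast
  qed
qed

text \<open>The eigenspace of \<open>mat_exp L\<close> for \<open>l\<close> is invariant under \<open>L\<close>. By the strip condition the only
  eigenvalue of \<open>L\<close> on it is \<open>ln l\<close>, and a nontrivial Jordan block would survive in the
  exponential. The induction runs over the roots of a polynomial in \<open>L\<close> that annihilates \<open>w\<close>.\<close>

lemma logarithm_on_complex_eigenspace:
  fixes L :: "real^'n^'n"
  assumes strip: "\<And>\<mu>. complex_eigenvalue L \<mu> \<Longrightarrow> \<bar>Im \<mu>\<bar> < pi" and l: "0 < l"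
    and "poly_mat_vec (complex_mat L) (\<Prod>x\<in>#R. [:-x, 1:]) w = 0"
    and "complex_mat (mat_exp L) *v w = complex_of_real l *s w"
  shows "complex_mat L *v w = complex_of_real (ln l) *s w"
  using assms(3,4)
proof (induction R arbitrary: w)
  case empty
  then have "w = 0" by (simp add: one_pCons)
  then show ?case by simp
next
  case (add x R)
  define T E c where "T = (*v) (complex_mat L)" and "E = (*v) (complex_mat (mat_exp L))"
    and "c = complex_of_real (ln l)"
  have lin: "T (a + b) = T a + T b" "T (a - b) = T a - T b" "T (z *s a) = z *s T a"
    "E (a + b) = E a + E b" "E (a - b) = E a - E b" "E (z *s a) = z *s E a" for a b z
    by (simp_all add: T_def E_def vec.add vec.diff vec.scale)
  have comm: "E (T a) = T (E a)" for a
    by (simp add: T_def E_def matrix_vector_mul_assoc mat_exp_commute flip: complex_mat_mult)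
  have Ew: "E w = complex_of_real l *s w" using add.prems(2) by (simp add: E_def)
  have exp_c: "exp c = complex_of_real l" using l by (simp add: c_def exp_of_real)
  \<comment> \<open>Peeling off the root \<open>x\<close>: since \<open>E\<close> commutes with
    \<open>T\<close>, the vector \<open>w'\<close> stays in the eigenspace of \<open>E\<close>, and
    the shorter product annihilates it.\<close>
  define w' where "w' = T w - x *s w"
  have Ew': "E w' = complex_of_real l *s w'"
    by (simp add: w'_def lin comm Ew vec.scale_right_diff_distrib vec.scale_left_commute)
  have "poly_mat_vec (complex_mat L) (\<Prod>x\<in>#R. [:-x, 1:]) w' = 0"
    using add.prems(1) unfolding w'_def T_def by (simp only: image_mset_add_mset prod_mset.add_mset poly_mat_vec_linear_factor)
  from add.IH[OF this] Ew' have Tw': "T w' = c *s w'" by (simp add: E_def T_def c_def)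
  have "T w = c *s w"
  proof (cases "x = c")
    case True
    have "complex_mat L *v w = c *s w + w'" by (simp add: w'_def T_def True)
    from mat_exp_complex_jordan[OF this] Tw' have "E w = exp c *s (w + w')" by (simp add: E_def T_def)
    then have "complex_of_real l *s w' = 0" by (simp add: Ew exp_c vec.scale_right_distrib)
    then have "w' = 0" using l by simp
    then show ?thesis by (simp add: w'_def True)
  next
    case False
    \<comment> \<open>\<open>T - c\<close> kills \<open>w' = (T - x) w\<close>, so
      \<open>T - x\<close> kills \<open>y = (T - c) w\<close>.\<close>
    define y where "y = T w - c *s w"
    have y: "y = w' + (x - c) *s w" by (simp add: y_def w'_def vec.scale_left_diff_distrib)
    have "T y = x *s y"
    proof -
      have "T y = c *s w' + (x - c) *s T w" by (simp add: y lin Tw')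
      also have "\<dots> = c *s w' + (x - c) *s (w' + x *s w)" by (simp add: w'_def)
      also have "\<dots> = x *s y" by (simp add: y vec_eq_iff ring_distribs mult_ac)
      finally show ?thesis .
    qed
    then have Ly: "complex_mat L *v y = x *s y" by (simp add: T_def)
    have "E y = exp x *s y" using mat_exp_complex_eigenvector[OF Ly] by (simp add: E_def)
    moreover have "E y = complex_of_real l *s y"
      by (simp add: y_def lin comm Ew vec.scale_right_diff_distrib vec.scale_left_commute)
    ultimately have ey: "exp x *s y = complex_of_real l *s y" by (rule trans[OF sym])
    have "y = 0"
    proof (rule ccontr)
      assume "y \<noteq> 0"
      then have ex: "exp x = complex_of_real l" using ey by (simp add: vec.scale_cancel_right)
      have "complex_eigenvalue L x" using Ly \<open>y \<noteq> 0\<close> by (auto simp: complex_eigenvalue_def)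
      then have "\<bar>Im x\<bar> < pi" by (rule strip)
      \<comment> \<open>\<open>Ln\<close> inverts \<open>exp\<close> on the strip; this is where the
        bound on imaginary parts enters.\<close>
      then have "x = Ln (exp x)" by (subst Ln_exp) auto
      also have "\<dots> = c" using l by (simp add: ex c_def Ln_of_real)
      finally show False using False by simp
    qed
    then show ?thesis by (simp add: y_def)
  qed
  then show ?case by (simp add: T_def c_def)
qed

text \<open>Complexify \<open>v\<close> and split an annihilating polynomial into linear factors
  over the complex numbers. The resulting eigenvalue \<open>ln l\<close> is real, so the equation
  can be read back.\<close>

lemma logarithm_on_eigenspace:
  fixes L :: "real^'n^'n"
  assumes strip: "\<And>\<mu>. complex_eigenvalue L \<mu> \<Longrightarrow> \<bar>Im \<mu>\<bar> < pi" and l: "0 < l"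
    and v: "mat_exp L *v v = l *\<^sub>R v"
  shows "L *v v = ln l *\<^sub>R v"
proof -
  obtain p where p: "p \<noteq> 0" "poly_mat_vec (complex_mat L) p (complex_vec v) = 0"
    by (rule annihilating_poly_exists)
  obtain R where R: "p = smult (lead_coeff p) (\<Prod>x\<in>#R. [:-x, 1:])"
    using alg_closed_imp_factorization[OF p(1)] by blast
  have "lead_coeff p *s poly_mat_vec (complex_mat L) (\<Prod>x\<in>#R. [:-x, 1:]) (complex_vec v) = 0"
    using p(2) unfolding poly_mat_vec_smult[symmetric] R[symmetric] .
  then have "poly_mat_vec (complex_mat L) (\<Prod>x\<in>#R. [:-x, 1:]) (complex_vec v) = 0"
    using p(1) by simp
  from logarithm_on_complex_eigenspace[OF strip l this]
  have "complex_mat L *v complex_vec v = complex_of_real (ln l) *s complex_vec v"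
    by (simp add: complex_mat_vec v complex_vec_scaleR)
  then show ?thesis by (simp add: complex_mat_vec complex_vec_inject flip: complex_vec_scaleR)
qed

section \<open>Logarithms of positive definite matrices\<close>

text \<open>For an eigenvector with real part \<open>a\<close> and imaginary part \<open>b\<close>,
  symmetry gives \<open>Im \<mu> * (a \<bullet> a + b \<bullet> b) = 0\<close>. Hence symmetric
  logarithms satisfy the strip condition in \<open>mat_log\<close>.\<close>

lemma complex_eigenvalue_symmetric_mat:
  fixes A :: "real^'n^'n"
  assumes sym: "symmetric_mat A" and "complex_eigenvalue A \<mu>"
  shows "Im \<mu> = 0"
proof -
  obtain v where v: "v \<noteq> 0" "complex_mat A *v v = \<mu> *s v"
    using assms(2) by (auto simp: complex_eigenvalue_def)
  define a b where "a = (\<chi> i. Re (v $ i))" and "b = (\<chi> i. Im (v $ i))"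
  have comp: "(\<Sum>j\<in>UNIV. complex_of_real (A $ i $ j) * v $ j) = \<mu> * v $ i" for i
    using arg_cong[OF v(2), of "\<lambda>x. x $ i"] by (simp add: matrix_vector_mult_def)
  have Aa: "A *v a = Re \<mu> *\<^sub>R a - Im \<mu> *\<^sub>R b"
    using arg_cong[OF comp, of Re] by (simp add: vec_eq_iff matrix_vector_mult_def a_def b_def)
  have Ab: "A *v b = Im \<mu> *\<^sub>R a + Re \<mu> *\<^sub>R b"
    using arg_cong[OF comp, of Im] by (simp add: vec_eq_iff matrix_vector_mult_def a_def b_def add.commute)
  have "Im \<mu> * (a \<bullet> a + b \<bullet> b) = 0"
    using symmetric_mat_inner[OF sym, of a b] unfolding Aa Ab
    by (simp add: inner_diff_left inner_add_right algebra_simps)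
  moreover have "a \<noteq> 0 \<or> b \<noteq> 0"
    using v(1) by (auto simp: vec_eq_iff a_def b_def complex_eq_iff)
  then have "a \<bullet> a + b \<bullet> b \<noteq> 0"
    by (metis add_nonneg_eq_0_iff inner_eq_zero_iff inner_ge_zero)
  ultimately show ?thesis by simp
qed

lemma eigensystem_exists:
  fixes u :: "'n::finite \<Rightarrow> real^'n"
  assumes "orthonormal_family u"
  obtains S where "eigensystem S u m"
proof -
  define f where "f x = (\<Sum>i\<in>UNIV. (m i * (u i \<bullet> x)) *\<^sub>R u i)" for x
  have "linear f"
    unfolding f_def by (rule linearI) (simp_all add: inner_add_right algebra_simps sum.distrib scaleR_sum_right)
  then have "matrix f *v x = f x" for x by (simp add: matrix_works)
  moreover have "f (u j) = m j *\<^sub>R u j" for j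
  proof -
    have "(m i * (u i \<bullet> u j)) *\<^sub>R u i = (if i = j then m j *\<^sub>R u j else 0)" for i
      using assms by (simp add: orthonormal_family_def)
    then show ?thesis by (simp add: f_def)
  qed
  ultimately have "eigensystem (matrix f) u m" using assms by (simp add: eigensystem_def)
  then show thesis by (rule that)
qed

text \<open>Prescribing the eigenvalues \<open>ln (l i)\<close> on \<open>u\<close> gives one
  logarithm. Any competitor \<open>L\<close>, symmetric or not, acts on \<open>u i\<close> by
  \<open>ln (l i)\<close> according to \<open>logarithm_on_eigenspace\<close>, which settles
  uniqueness.\<close>

theorem mat_log_eigensystem:
  fixes A :: "real^'n^'n"
  assumes A: "eigensystem A u l" and pos: "\<And>i. 0 < l i"
  shows "eigensystem (mat_log A) u (\<lambda>i. ln (l i))" and "mat_exp (mat_log A) = A"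
proof -
  obtain S where S: "eigensystem S u (\<lambda>i. ln (l i))"
    by (rule eigensystem_exists[OF eigensystem_orthonormal[OF A]])
  have "eigensystem (mat_exp S) u l" using eigensystem_mat_exp[OF S] pos by simp
  then have exp_S: "mat_exp S = A" using A by (rule eigensystem_unique)
  have "mat_log A = S"
    unfolding mat_log_def
  proof (rule the_equality)
    show "mat_exp S = A \<and> (\<forall>\<mu>. complex_eigenvalue S \<mu> \<longrightarrow> \<bar>Im \<mu>\<bar> < pi)"
      using exp_S complex_eigenvalue_symmetric_mat[OF eigensystem_symmetric[OF S]] by simp
  next
    fix L assume L: "mat_exp L = A \<and> (\<forall>\<mu>. complex_eigenvalue L \<mu> \<longrightarrow> \<bar>Im \<mu>\<bar> < pi)"
    have "L *v u i = ln (l i) *\<^sub>R u i" for i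
      using L A pos by (intro logarithm_on_eigenspace) (auto simp: eigensystem_def)
    then have "eigensystem L u (\<lambda>i. ln (l i))" using A by (simp add: eigensystem_def)
    then show "L = S" using S by (rule eigensystem_unique)
  qed
  with S exp_S show "eigensystem (mat_log A) u (\<lambda>i. ln (l i))" "mat_exp (mat_log A) = A" by auto
qed

lemma mat_exp_mat_log: "A \<in> spd \<Longrightarrow> mat_exp (mat_log A) = A"
  by (metis mat_log_eigensystem(2) spd_eigensystem)

lemma mat_log_symmetric: "A \<in> spd \<Longrightarrow> symmetric_mat (mat_log A)"
  by (metis mat_log_eigensystem(1) spd_eigensystem eigensystem_symmetric)

lemma mat_log_mat_exp:
  assumes "symmetric_mat S"
  shows "mat_log (mat_exp S) = S"
proof -
  obtain u l where S: "eigensystem S u l" using symmetric_mat_eigensystem[OF assms] .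
  have "eigensystem (mat_log (mat_exp S)) u (\<lambda>i. ln (exp (l i)))"
    by (intro mat_log_eigensystem eigensystem_mat_exp[OF S]) simp
  then show ?thesis using eigensystem_unique S by simp
qed

subsection \<open>Compression and Lipschitz bounds\<close>

lemma mat_vector_mult: "mat c *v x = c *\<^sub>R (x :: real^'n)"
  by (simp add: vec_eq_iff matrix_vector_mult_def mat_def if_distrib if_distribR cong: if_cong)

lemma spd_betweenD:
  fixes X :: "real^'n^'n"
  assumes "X \<in> spd_between \<alpha> \<beta>"
  shows "X \<in> spd" "\<alpha> * (x \<bullet> x) \<le> x \<bullet> (X *v x)" "x \<bullet> (X *v x) \<le> \<beta> * (x \<bullet> x)"
  using assms
  by (auto simp: spd_between_def loewner_le_def psd_def matrix_vector_mult_diff_rdistrib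
      inner_diff_right mat_vector_mult)

section \<open>Scalar estimates and their transfer to matrices\<close>

text \<open>The tangent bound for \<open>ln\<close> at the smaller point; that point is then
  replaced by \<alpha> in the denominator.\<close>

lemma abs_ln_diff_le:
  fixes \<alpha> :: real
  assumes "0 < \<alpha>" "\<alpha> \<le> s" "\<alpha> \<le> t"
  shows "\<bar>ln s - ln t\<bar> \<le> 1 / \<alpha> * \<bar>s - t\<bar>"
proof -
  have *: "\<bar>ln s - ln t\<bar> \<le> 1 / \<alpha> * \<bar>s - t\<bar>" if "\<alpha> \<le> t" "t \<le> s" for s t :: real
  proof -
    have "ln s - ln t \<le> (s - t) / t" using that assms(1) by (intro ln_diff_le) auto
    also have "\<dots> \<le> (s - t) / \<alpha>" using that assms(1) by (intro divide_left_mono) auto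
    finally show ?thesis using that assms(1) by simp
  qed
  show ?thesis
    using *[of t s] *[of s t] assms by (cases "t \<le> s") (auto simp: abs_minus_commute)
qed

text \<open>Here the tangent is taken at the larger point, which bounds the difference of logarithms
  from below; that point is then replaced by \<beta>.\<close>

lemma abs_diff_le_ln:
  fixes \<beta> :: real
  assumes "0 < s" "0 < t" "s \<le> \<beta>" "t \<le> \<beta>"
  shows "\<bar>s - t\<bar> \<le> \<beta> * \<bar>ln s - ln t\<bar>"
proof -
  have *: "\<bar>s - t\<bar> \<le> \<beta> * \<bar>ln s - ln t\<bar>" if "0 < t" "t \<le> s" "s \<le> \<beta>" for s t :: real
  proof -
    have "ln t - ln s \<le> (t - s) / s" using that by (intro ln_diff_le) auto
    then have "s - t \<le> s * (ln s - ln t)" using that by (simp add: field_simps)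
    also have "\<dots> \<le> \<beta> * (ln s - ln t)" using that by (intro mult_right_mono) auto
    finally show ?thesis using that by simp
  qed
  show ?thesis
    using *[of t s] *[of s t] assms by (cases "t \<le> s") (auto simp: abs_minus_commute)
qed

text \<open>Evaluating the forms at eigenvectors turns the lower bounds into eigenvalue bounds, and
  \<open>ln\<close> is Lipschitz with constant \<open>1 / \<alpha>\<close> there.\<close>

lemma norm_mat_log_diff_le:
  fixes A B :: "real^'n^'n"
  assumes "A \<in> spd" "B \<in> spd" and \<alpha>: "0 < \<alpha>"
    and "\<And>x. \<alpha> * (x \<bullet> x) \<le> x \<bullet> (A *v x)" "\<And>x. \<alpha> * (x \<bullet> x) \<le> x \<bullet> (B *v x)"
  shows "norm (mat_log A - mat_log B) \<le> 1 / \<alpha> * norm (A - B)"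
proof -
  obtain u l where A: "eigensystem A u l" "\<And>i. 0 < l i" using spd_eigensystem assms(1) by blast
  obtain w m where B: "eigensystem B w m" "\<And>i. 0 < m i" using spd_eigensystem assms(2) by blast
  have "\<alpha> \<le> l i" "\<alpha> \<le> m i" for i
    using assms(4)[of "u i"] assms(5)[of "w i"] A(1) B(1)
      eigensystem_eigenvalue[OF A(1), of i] eigensystem_eigenvalue[OF B(1), of i]
    unfolding eigensystem_def orthonormal_family_def by auto
  then show ?thesis
    using \<alpha> by (intro norm_diff_le_eigensystem[OF A(1) B(1) mat_log_eigensystem(1)[OF A] mat_log_eigensystem(1)[OF B]]
        abs_ln_diff_le) auto
qed

text \<open>The same transfer with matrices and logarithms exchanged: \<open>exp\<close> is
  Lipschitz with constant \<beta> up to \<open>ln \<beta>\<close>.\<close>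

lemma norm_diff_le_mat_log:
  fixes A B :: "real^'n^'n"
  assumes "A \<in> spd" "B \<in> spd"
    and "\<And>x. x \<bullet> (A *v x) \<le> \<beta> * (x \<bullet> x)" "\<And>x. x \<bullet> (B *v x) \<le> \<beta> * (x \<bullet> x)"
  shows "norm (A - B) \<le> \<beta> * norm (mat_log A - mat_log B)"
proof -
  obtain u l where A: "eigensystem A u l" "\<And>i. 0 < l i" using spd_eigensystem assms(1) by blast
  obtain w m where B: "eigensystem B w m" "\<And>i. 0 < m i" using spd_eigensystem assms(2) by blast
  have le: "l i \<le> \<beta>" "m i \<le> \<beta>" for i
    using assms(3)[of "u i"] assms(4)[of "w i"] A(1) B(1)
      eigensystem_eigenvalue[OF A(1), of i] eigensystem_eigenvalue[OF B(1), of i]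
    unfolding eigensystem_def orthonormal_family_def by auto
  then have "0 \<le> \<beta>" using A(2) by (meson less_imp_le order_trans)
  then show ?thesis
    using A(2) B(2) le
    by (intro norm_diff_le_eigensystem[OF mat_log_eigensystem(1)[OF A] mat_log_eigensystem(1)[OF B] A(1) B(1)]
        abs_diff_le_ln) auto
qed

lemma inner_mat_log_ge:
  fixes A :: "real^'n^'n"
  assumes "A \<in> spd" "0 < c" "\<And>x. c * (x \<bullet> x) \<le> x \<bullet> (A *v x)"
  shows "ln c * (y \<bullet> y) \<le> y \<bullet> (mat_log A *v y)"
proof -
  obtain u l where A: "eigensystem A u l" "\<And>i. 0 < l i" using spd_eigensystem assms(1) by blast
  have "c \<le> l i" for i
    using assms(3)[of "u i"] A(1) eigensystem_eigenvalue[OF A(1), of i]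
    unfolding eigensystem_def orthonormal_family_def by auto
  then show ?thesis
    using A(2) assms(2) by (intro eigensystem_ge[OF mat_log_eigensystem(1)[OF A]]) (auto intro: ln_mono)
qed

lemma inner_mat_log_le:
  fixes A :: "real^'n^'n"
  assumes "A \<in> spd" "0 < c" "\<And>x. x \<bullet> (A *v x) \<le> c * (x \<bullet> x)"
  shows "y \<bullet> (mat_log A *v y) \<le> ln c * (y \<bullet> y)"
proof -
  obtain u l where A: "eigensystem A u l" "\<And>i. 0 < l i" using spd_eigensystem assms(1) by blast
  have "l i \<le> c" for i
    using assms(3)[of "u i"] A(1) eigensystem_eigenvalue[OF A(1), of i]
    unfolding eigensystem_def orthonormal_family_def by auto
  then show ?thesis
    using A(2) assms(2) by (intro eigensystem_le[OF mat_log_eigensystem(1)[OF A]]) (auto intro: ln_mono)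
qed

text \<open>The eigenspace argument applies to \<open>mat_log A\<close> itself, so \<open>v\<close>
  can be any eigenvector and not only a member of a chosen eigenbasis.\<close>

lemma mat_log_eigenvector:
  fixes A :: "real^'n^'n"
  assumes "A \<in> spd" "0 < l" "A *v v = l *\<^sub>R v"
  shows "mat_log A *v v = ln l *\<^sub>R v"
  using assms complex_eigenvalue_symmetric_mat[OF mat_log_symmetric[OF assms(1)]]
  by (intro logarithm_on_eigenspace) (auto simp: mat_exp_mat_log)

section \<open>Compression by a matrix with orthonormal rows\<close>

context
  fixes W :: "real^'m^'k"
  assumes W: "W ** transpose W = mat 1"
begin

lemma coisometry_mult_transpose: "W *v (transpose W *v y) = y"
  by (simp only: matrix_vector_mul_assoc W matrix_vector_mul_lid)

lemma inner_transpose_mult: "x \<bullet> (transpose W *v y) = (W *v x) \<bullet> y"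
  by (metis dot_lmul_matrix inner_commute transpose_matrix_vector)

lemma norm_transpose_coisometry: "norm (transpose W *v y) = norm y"
  unfolding norm_eq_sqrt_inner inner_transpose_mult coisometry_mult_transpose ..

text \<open>Pythagoras for \<open>transpose W ** W\<close>, the orthogonal projection onto the row
  space of \<open>W\<close>.\<close>

lemma norm_diff_coisometry_projection:
  "(norm (x - transpose W *v (W *v x)))\<^sup>2 = (norm x)\<^sup>2 - (norm (W *v x))\<^sup>2"
  unfolding power2_norm_eq_inner inner_diff_left inner_diff_right inner_transpose_mult
    inner_commute[of "transpose W *v _" x] coisometry_mult_transpose matrix_vector_mult_diff_distrib
  by simp

lemma norm_coisometry_le: "norm (W *v x) \<le> norm x"
  using zero_le_power2[of "norm (x - transpose W *v (W *v x))"]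
  unfolding norm_diff_coisometry_projection by (simp add: power2_le_imp_le[of "norm (W *v x)"])

text \<open>Without loss of length there is no component orthogonal to the row space; vectors
  outside it are therefore strictly shortened.\<close>

lemma coisometry_norm_eq_imp: "norm (W *v x) = norm x \<Longrightarrow> transpose W *v (W *v x) = x"
  using norm_diff_coisometry_projection[of x] by simp

lemma inner_compression:
  "x \<bullet> ((W ** X ** transpose W) *v y) = (transpose W *v x) \<bullet> (X *v (transpose W *v y))"
  by (metis inner_commute inner_transpose_mult matrix_vector_mul_assoc)

lemma symmetric_mat_compression:
  assumes "symmetric_mat X"
  shows "symmetric_mat (W ** X ** transpose W)"
  by (rule symmetric_matI) (metis inner_commute inner_compression symmetric_mat_inner[OF assms])

lemma compression_spd:
  assumes "X \<in> spd"
  shows "W ** X ** transpose W \<in> spd"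
  unfolding spd_def
proof (intro CollectI conjI allI impI)
  show "symmetric_mat (W ** X ** transpose W)"
    using assms by (auto simp: spd_def intro: symmetric_mat_compression)
  fix v :: "real^'k" assume "v \<noteq> 0"
  then have "transpose W *v v \<noteq> 0" using norm_transpose_coisometry[of v] by auto
  then show "0 < v \<bullet> ((W ** X ** transpose W) *v v)"
    using assms unfolding inner_compression spd_def by blast
qed

lemma compression_ge:
  assumes "\<And>x. c * (x \<bullet> x) \<le> x \<bullet> (X *v x)"
  shows "c * (y \<bullet> y) \<le> y \<bullet> ((W ** X ** transpose W) *v y)"
  using assms[of "transpose W *v y"]
  unfolding inner_compression by (simp only: inner_transpose_mult coisometry_mult_transpose)

lemma compression_le:
  assumes "\<And>x. x \<bullet> (X *v x) \<le> c * (x \<bullet> x)"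
  shows "y \<bullet> ((W ** X ** transpose W) *v y) \<le> c * (y \<bullet> y)"
  using assms[of "transpose W *v y"]
  unfolding inner_compression by (simp only: inner_transpose_mult coisometry_mult_transpose)

text \<open>Each row of the product is \<open>W\<close> applied to a row of \<open>M\<close>, and
  \<open>W\<close> does not lengthen vectors.\<close>

lemma norm_mult_transpose_coisometry_le:
  fixes M :: "real^'m^'p"
  shows "norm (M ** transpose W) \<le> norm M"
proof -
  have row: "(M ** transpose W) $ i = W *v (M $ i)" for i
    by (simp add: vec_eq_iff matrix_matrix_mult_def matrix_vector_mult_def transpose_def mult.commute)
  show ?thesis
    unfolding norm_vec_def[of "M ** transpose W"] norm_vec_def[of M] row
    by (intro L2_set_mono norm_coisometry_le) simp
qed

text \<open>The one-sided bound is used twice, with a transposition in between to reach the left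
  factor.\<close>

lemma norm_compression_le: "norm (W ** M ** transpose W) \<le> norm M"
proof -
  have "norm (W ** M ** transpose W) \<le> norm (transpose (W ** M))"
    using norm_mult_transpose_coisometry_le[of "W ** M"] by simp
  also have "\<dots> = norm (transpose M ** transpose W)" by (simp add: matrix_transpose_mul)
  also have "\<dots> \<le> norm M" using norm_mult_transpose_coisometry_le[of "transpose M"] by simp
  finally show ?thesis .
qed

text \<open>Three constants multiply: \<open>1 / \<alpha>\<close> for the logarithm of the
  compressions, 1 for the compression, and \<beta> for passing from \<open>X - Z\<close> to the
  difference of logarithms.\<close>

lemma norm_mat_log_compression_diff_le:
  assumes "0 < \<alpha>" and X: "X \<in> spd_between \<alpha> \<beta>" and Z: "Z \<in> spd_between \<alpha> \<beta>"
  shows "norm (mat_log (W ** X ** transpose W) - mat_log (W ** Z ** transpose W)) \<le> \<beta> / \<alpha> * dist_LE X Z"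
proof -
  note X = spd_betweenD[OF X] and Z = spd_betweenD[OF Z]
  have "norm (mat_log (W ** X ** transpose W) - mat_log (W ** Z ** transpose W))
      \<le> 1 / \<alpha> * norm (W ** X ** transpose W - W ** Z ** transpose W)"
    using assms(1) X Z by (intro norm_mat_log_diff_le compression_spd compression_ge) auto
  also have "W ** X ** transpose W - W ** Z ** transpose W = W ** (X - Z) ** transpose W"
    by (simp add: matrix_eq matrix_vector_mult_diff_rdistrib matrix_vector_mult_diff_distrib flip: matrix_vector_mul_assoc)
  also have "1 / \<alpha> * norm (W ** (X - Z) ** transpose W) \<le> 1 / \<alpha> * norm (X - Z)"
    using assms(1) by (intro mult_left_mono norm_compression_le) auto
  also have "\<dots> \<le> 1 / \<alpha> * (\<beta> * norm (mat_log X - mat_log Z))"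
    using assms(1) X Z by (intro mult_left_mono norm_diff_le_mat_log) auto
  finally show ?thesis by (simp add: dist_LE_def)
qed

end

subsection \<open>The Log-Euclidean mean map\<close>

lemma sum_matrix_vector_mult:
  fixes L :: "'b \<Rightarrow> real^'n^'m"
  shows "(\<Sum>h\<in>I. L h) *v x = (\<Sum>h\<in>I. L h *v x)"
  by (induction I rule: infinite_finite_induct) (simp_all add: matrix_vector_mult_add_rdistrib)

lemma symmetric_mat_scaleR_sum:
  assumes "\<And>h. h \<in> I \<Longrightarrow> symmetric_mat (L h)"
  shows "symmetric_mat (c *\<^sub>R (\<Sum>h\<in>I. L h))"
  using assms
  by (intro symmetric_matI)
    (simp add: scaleR_matrix_vector_assoc[symmetric]
      sum_matrix_vector_mult inner_sum_left inner_sum_right symmetric_mat_inner)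

text \<open>Steiner's identity: the cross terms cancel because the deviations from the mean sum to
  zero.\<close>

lemma sum_norm_diff_mean:
  fixes L :: "nat \<Rightarrow> 'a::real_inner"
  assumes H: "1 \<le> H" and M: "M = (1 / real H) *\<^sub>R (\<Sum>h=1..H. L h)"
  shows "(\<Sum>h=1..H. (norm (X - L h))\<^sup>2) = (\<Sum>h=1..H. (norm (M - L h))\<^sup>2) + real H * (norm (X - M))\<^sup>2"
proof -
  have "(norm (X - L h))\<^sup>2 = (norm (M - L h))\<^sup>2 + (norm (X - M))\<^sup>2 + 2 * ((X - M) \<bullet> (M - L h))" for h
    unfolding power2_norm_eq_inner inner_diff_left inner_diff_right
    by (simp add: inner_commute)
  then have "(\<Sum>h=1..H. (norm (X - L h))\<^sup>2) = (\<Sum>h=1..H. (norm (M - L h))\<^sup>2) + real H * (norm (X - M))\<^sup>2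
      + 2 * ((X - M) \<bullet> (\<Sum>h=1..H. M - L h))"
    by (simp add: sum.distrib inner_sum_right sum_distrib_left)
  moreover have "(\<Sum>h=1..H. M - L h) = real H *\<^sub>R M - (\<Sum>h=1..H. L h)"
    by (simp add: sum_subtractf sum_constant_scaleR)
  then have "(\<Sum>h=1..H. M - L h) = 0" using H M by simp
  ultimately show ?thesis by simp
qed

lemma symmetric_mat_mean_mat_log:
  assumes "\<And>h. h \<in> {1..H} \<Longrightarrow> Y h \<in> spd"
  shows "symmetric_mat ((1 / real H) *\<^sub>R (\<Sum>h=1..H. mat_log (Y h)))"
  using assms by (intro symmetric_mat_scaleR_sum mat_log_symmetric)

text \<open>In logarithmic coordinates the distance is Euclidean, so
  \<open>sum_norm_diff_mean\<close> applies. Strictness comes from the injectivity of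
  \<open>mat_log\<close> on \<open>spd\<close>.\<close>

lemma is_LE_frechet_mean_exp_mean_log:
  assumes H: "1 \<le> H" and Y: "\<And>h. h \<in> {1..H} \<Longrightarrow> Y h \<in> spd"
  shows "is_LE_frechet_mean H Y (mat_exp ((1 / real H) *\<^sub>R (\<Sum>h=1..H. mat_log (Y h))))"
proof -
  define M where "M = (1 / real H) *\<^sub>R (\<Sum>h=1..H. mat_log (Y h))"
  have sym: "symmetric_mat M" unfolding M_def using Y by (rule symmetric_mat_mean_mat_log)
  have "(\<Sum>h=1..H. (dist_LE (mat_exp M) (Y h))\<^sup>2) < (\<Sum>h=1..H. (dist_LE X (Y h))\<^sup>2)"
    if X: "X \<in> spd" "X \<noteq> mat_exp M" for X
  proof -
    have "mat_log X \<noteq> M" using X mat_exp_mat_log by metis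
    then have "0 < real H * (norm (mat_log X - M))\<^sup>2" using H by simp
    then show ?thesis
      unfolding dist_LE_def mat_log_mat_exp[OF sym]
        sum_norm_diff_mean[OF H M_def, of "mat_log X"] by simp
  qed
  then show ?thesis
    using mat_exp_spd[OF sym] unfolding is_LE_frechet_mean_def M_def[symmetric] by blast
qed

lemma mat_log_LE_mean_map:
  fixes W :: "nat \<Rightarrow> real^'m^'k"
  assumes "\<forall>h\<in>{1..H}. W h ** transpose (W h) = mat 1" "X \<in> spd"
  shows "mat_log (LE_mean_map H W X) = (1 / real H) *\<^sub>R (\<Sum>h=1..H. mat_log (W h ** X ** transpose (W h)))"
  unfolding LE_mean_map_def
proof (rule mat_log_mat_exp, rule symmetric_mat_mean_mat_log)
  fix h assume "h \<in> {1..H}"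
  then show "W h ** X ** transpose (W h) \<in> spd" using assms by (simp add: compression_spd)
qed

text \<open>The logarithm of the map is an average of logarithms, so the triangle inequality passes
  the bound for single compressions to the mean.\<close>

lemma dist_LE_mean_map_le:
  fixes W :: "nat \<Rightarrow> real^'m^'k"
  assumes H: "1 \<le> H" and W: "\<And>h. h \<in> {1..H} \<Longrightarrow> W h ** transpose (W h) = mat 1"
    and \<alpha>: "0 < \<alpha>" and X: "X \<in> spd_between \<alpha> \<beta>" and Z: "Z \<in> spd_between \<alpha> \<beta>"
  shows "dist_LE (LE_mean_map H W X) (LE_mean_map H W Z) \<le> \<beta> / \<alpha> * dist_LE X Z"
proof -
  have W': "\<forall>h\<in>{1..H}. W h ** transpose (W h) = mat 1" using W by blast
  let ?D = "\<lambda>h. mat_log (W h ** X ** transpose (W h)) - mat_log (W h ** Z ** transpose (W h))"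
  have "dist_LE (LE_mean_map H W X) (LE_mean_map H W Z) = 1 / real H * norm (\<Sum>h=1..H. ?D h)"
    unfolding dist_LE_def mat_log_LE_mean_map[OF W' spd_betweenD(1)[OF X]]
      mat_log_LE_mean_map[OF W' spd_betweenD(1)[OF Z]]
    unfolding scaleR_diff_right[symmetric] sum_subtractf[symmetric] by simp
  also have "norm (\<Sum>h=1..H. ?D h) \<le> (\<Sum>h=1..H. \<beta> / \<alpha> * dist_LE X Z)"
    by (intro sum_norm_le norm_mat_log_compression_diff_le[OF W \<alpha> X Z])
  then have "1 / real H * norm (\<Sum>h=1..H. ?D h) \<le> 1 / real H * (\<Sum>h=1..H. \<beta> / \<alpha> * dist_LE X Z)"
    by (intro mult_left_mono) auto
  also have "\<dots> = \<beta> / \<alpha> * dist_LE X Z" using H by simp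
  finally show ?thesis .
qed

subsection \<open>Failure of non-expansiveness\<close>

definition outer_square :: "real^'n \<Rightarrow> real^'n^'n" where
  "outer_square v = (\<chi> i j. v $ i * v $ j)"

lemma outer_square_mult: "outer_square v *v x = (v \<bullet> x) *\<^sub>R v"
  by (simp add: vec_eq_iff outer_square_def matrix_vector_mult_def inner_vec_def sum_distrib_left mult_ac)

lemma symmetric_mat_outer_square: "symmetric_mat (c *\<^sub>R outer_square v)"
  by (rule symmetric_matI)
    (simp add: scaleR_matrix_vector_assoc[symmetric] outer_square_mult inner_commute)

text \<open>For a unit vector \<open>v\<close> the eigenvalues are \<open>exp (- t)\<close> along
  \<open>v\<close> and 1 on its orthogonal complement.\<close>

definition spike :: "real^'n \<Rightarrow> real \<Rightarrow> real^'n^'n" where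
  "spike v t = mat_exp (- t *\<^sub>R outer_square v)"

lemma spike_spd: "spike v t \<in> spd"
  unfolding spike_def by (intro mat_exp_spd symmetric_mat_outer_square)

lemma mat_log_spike: "mat_log (spike v t) = - t *\<^sub>R outer_square v"
  unfolding spike_def by (intro mat_log_mat_exp symmetric_mat_outer_square)

lemma dist_LE_spike:
  assumes "0 \<le> t"
  shows "dist_LE (spike v t) (spike w t) = t * norm (outer_square v - outer_square w)"
proof -
  have "mat_log (spike v t) - mat_log (spike w t) = - t *\<^sub>R (outer_square v - outer_square w)"
    by (simp only: mat_log_spike scaleR_diff_right)
  then show ?thesis using assms by (simp add: dist_LE_def)
qed

lemma spike_mult:
  fixes v :: "real^'n"
  assumes v: "norm v = 1"
  shows "spike v t *v x = x - ((1 - exp (- t)) * (v \<bullet> x)) *\<^sub>R v"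
proof -
  have vv: "v \<bullet> v = 1" using v by (simp add: dot_square_norm)
  have v_eig: "spike v t *v v = exp (- t) *\<^sub>R v"
    unfolding spike_def by (rule mat_exp_eigenvector)
      (simp only: scaleR_matrix_vector_assoc[symmetric] outer_square_mult vv scaleR_one)
  \<comment> \<open>The part of \<open>x\<close> orthogonal to \<open>v\<close> lies in the kernel
    of the exponent, so the spike fixes it.\<close>
  define y where "y = x - (v \<bullet> x) *\<^sub>R v"
  have "v \<bullet> y = 0" by (simp add: y_def inner_diff_right vv)
  then have "(- t *\<^sub>R outer_square v) *v y = 0 *\<^sub>R y"
    by (simp only: scaleR_matrix_vector_assoc[symmetric] outer_square_mult scaleR_zero_left scaleR_zero_right)
  from mat_exp_eigenvector[OF this] have y_eig: "spike v t *v y = y" by (simp add: spike_def)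
  have "x = y + (v \<bullet> x) *\<^sub>R v" by (simp add: y_def)
  then have "spike v t *v x = spike v t *v y + (v \<bullet> x) *\<^sub>R (spike v t *v v)"
    by (metis matrix_vector_mult_scaleR matrix_vector_right_distrib)
  also have "\<dots> = x - ((1 - exp (- t)) * (v \<bullet> x)) *\<^sub>R v"
    unfolding y_eig v_eig by (simp add: y_def algebra_simps)
  finally show ?thesis .
qed

lemma inner_spike:
  assumes "norm v = 1"
  shows "x \<bullet> (spike v t *v x) = x \<bullet> x - (1 - exp (- t)) * (v \<bullet> x)\<^sup>2"
  unfolding spike_mult[OF assms]
  by (simp add: inner_diff_right power2_eq_square inner_commute[of x v])

lemma inner_spike_le:
  assumes "norm v = 1" "0 \<le> t"
  shows "x \<bullet> (spike v t *v x) \<le> 1 * (x \<bullet> x)"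
  unfolding inner_spike[OF assms(1)] using assms(2) by simp

text \<open>Bounding \<open>1 - exp (- t)\<close> by 1 makes the lower bound independent of
  \<open>t\<close>. It is positive when \<open>norm (W *v v) < 1\<close>, that is, when
  \<open>v\<close> lies outside the row space.\<close>

lemma compression_spike_ge:
  fixes W :: "real^'m^'k"
  assumes W: "W ** transpose W = mat 1" and v: "norm v = 1"
  shows "(1 - (norm (W *v v))\<^sup>2) * (y \<bullet> y) \<le> y \<bullet> ((W ** spike v t ** transpose W) *v y)"
proof -
  have "(1 - exp (- t)) * ((W *v v) \<bullet> y)\<^sup>2 \<le> 1 * ((W *v v) \<bullet> y)\<^sup>2"
    by (intro mult_right_mono) auto
  also have "\<dots> \<le> (norm (W *v v))\<^sup>2 * (y \<bullet> y)"
    using Cauchy_Schwarz_ineq[of "W *v v" y] by (simp add: dot_square_norm)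
  finally show ?thesis
    unfolding inner_compression[OF W] inner_spike[OF v] inner_transpose_mult[OF W]
      coisometry_mult_transpose[OF W]
    by (simp add: algebra_simps)
qed

lemma outer_square_sgn_tendsto:
  fixes v :: "real^'n"
  assumes "norm v = 1"
  shows "((\<lambda>z. outer_square (sgn z)) \<longlongrightarrow> outer_square v) (nhds v)"
proof -
  have "v \<noteq> 0" "sgn v = v" using assms by (auto simp: sgn_div_norm)
  then have "((\<lambda>z. sgn z) \<longlongrightarrow> v) (nhds v)"
    using tendsto_sgn[OF filterlim_ident[of "nhds v"]] by simp
  then show ?thesis
    unfolding outer_square_def by (intro tendsto_vec_lambda tendsto_mult tendsto_vec_nth)
qed

text \<open>Each row space has dimension below that of the whole space and is a null set, so
  finitely many of them cannot fill a ball around \<open>v\<close>. Normalising a point keeps it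
  outside.\<close>

lemma generic_unit_vector:
  fixes W :: "nat \<Rightarrow> real^'m^'k" and v :: "real^'m"
  assumes card: "CARD('k) < CARD('m)" and I: "finite I"
    and W: "\<And>h. h \<in> I \<Longrightarrow> W h ** transpose (W h) = mat 1"
    and v: "norm v = 1" and e: "0 < e"
  obtains v' where "norm v' = 1" "norm (outer_square v' - outer_square v) < e"
    "\<And>h. h \<in> I \<Longrightarrow> norm (W h *v v') < 1"
proof -
  define R where "R h = range ((*v) (transpose (W h)))" for h
  \<comment> \<open>Excluding 0 explicitly ensures that the chosen \<open>z\<close> can be
    normalised.\<close>
  define N where "N = insert 0 (\<Union>h\<in>I. R h)"
  have "negligible (R h)" for h
  proof (rule negligible_lowdim)
    have "dim (R h) \<le> dim (UNIV :: (real^'k) set)"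
      unfolding R_def by (rule dim_image_le) simp
    then show "dim (R h) < DIM(real^'m)" using card by simp
  qed
  then have neg: "negligible N" unfolding N_def using I by (auto intro!: negligible_Union)
  have "eventually (\<lambda>z. dist (outer_square (sgn z)) (outer_square v) < e) (nhds v)"
    using tendstoD[OF outer_square_sgn_tendsto[OF v] e] .
  then obtain d where d: "0 < d" "\<And>z. dist z v < d \<Longrightarrow> dist (outer_square (sgn z)) (outer_square v) < e"
    unfolding eventually_nhds_metric by blast
  have "\<not> ball v d \<subseteq> N"
    using neg negligible_subset open_not_negligible[of "ball v d"] d(1) by auto
  then obtain z where z: "dist z v < d" "z \<notin> N"
    by (metis dist_commute mem_ball subsetI)
  have "z \<noteq> 0" using z(2) by (simp add: N_def)
  then have n1: "norm (sgn z) = 1" by (simp add: norm_sgn)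
  have "norm (W h *v sgn z) < 1" if h: "h \<in> I" for h
  proof (rule ccontr)
    assume "\<not> norm (W h *v sgn z) < 1"
    then have "norm (W h *v sgn z) = norm (sgn z)"
      using norm_coisometry_le[OF W[OF h], of "sgn z"] n1 by simp
    then have "transpose (W h) *v (W h *v sgn z) = sgn z"
      by (rule coisometry_norm_eq_imp[OF W[OF h]])
    then have "transpose (W h) *v (norm z *\<^sub>R (W h *v sgn z)) = norm z *\<^sub>R sgn z"
      by (simp only: matrix_vector_mult_scaleR)
    also have "\<dots> = z" using \<open>z \<noteq> 0\<close> by (simp add: sgn_div_norm)
    finally have "z \<in> R h" unfolding R_def by (metis rangeI)
    then show False using z(2) h by (auto simp: N_def)
  qed
  then show thesis using that[of "sgn z"] n1 d(2)[OF z(1)] by (simp add: dist_norm)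
qed

lemma inner_mat_log_LE_mean_map:
  fixes W :: "nat \<Rightarrow> real^'m^'k"
  assumes "\<forall>h\<in>{1..H}. W h ** transpose (W h) = mat 1" "X \<in> spd"
  shows "y \<bullet> (mat_log (LE_mean_map H W X) *v y)
    = (\<Sum>h=1..H. y \<bullet> (mat_log (W h ** X ** transpose (W h)) *v y)) / real H"
  unfolding mat_log_LE_mean_map[OF assms]
  by (simp add: scaleR_matrix_vector_assoc[symmetric] sum_matrix_vector_mult inner_sum_right)

lemma not_nonexpansive_LE_mean_map:
  fixes W :: "nat \<Rightarrow> real^'m^'k"
  assumes card: "CARD('k) < CARD('m)" and H: "1 \<le> H"
    and W: "\<And>h. h \<in> {1..H} \<Longrightarrow> W h ** transpose (W h) = mat 1"
  shows "\<not> nonexpansive_map spd dist_LE dist_LE (LE_mean_map H W)"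
proof
  assume ne: "nonexpansive_map spd dist_LE dist_LE (LE_mean_map H W)"
  obtain y :: "real^'k" where y: "norm y = 1" using vector_choose_size[of 1] by auto
  have yy: "y \<bullet> y = 1" using y by (simp add: dot_square_norm)
  have W': "\<forall>h\<in>{1..H}. W h ** transpose (W h) = mat 1" using W by blast
  have W1: "W 1 ** transpose (W 1) = mat 1" using W H by simp
  define v where "v = transpose (W 1) *v y"
  have v: "norm v = 1" "W 1 *v v = y"
    unfolding v_def norm_transpose_coisometry[OF W1] coisometry_mult_transpose[OF W1] using y by auto
  \<comment> \<open>The tolerance keeps the distance of the two spikes at most
    \<open>t / (2 * real H)\<close>, half of the drop \<open>t / real H\<close> that
    \<open>v\<close> causes in the output.\<close>
  obtain v' where v': "norm v' = 1" "norm (outer_square v' - outer_square v) < 1 / (2 * real H)"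
    "\<And>h. h \<in> {1..H} \<Longrightarrow> norm (W h *v v') < 1"
    using generic_unit_vector[of "{1..H}" W v "1 / (2 * real H)", OF card _ W v(1)] H by auto
  \<comment> \<open>A positive lower bound common to all compressions of the spike at
    \<open>v'\<close>, for every \<open>t\<close>.\<close>
  define c where "c = Min ((\<lambda>h. 1 - (norm (W h *v v'))\<^sup>2) ` {1..H})"
  have c: "0 < c"
    unfolding c_def using H v'(3) by (subst Min_gr_iff) (auto simp: power_less_one_iff abs_square_less_1)
  have c_le: "c \<le> 1 - (norm (W h *v v'))\<^sup>2" if "h \<in> {1..H}" for h
    unfolding c_def using that by (intro Min_le) auto
  \<comment> \<open>Non-expansiveness would force \<open>t / (2 * real H) \<le> - ln c\<close>, but
    this \<open>t\<close> makes the left side \<open>1 + \<bar>ln c\<bar>\<close>.\<close>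
  define t where "t = 2 * real H * (1 + \<bar>ln c\<bar>)"
  have t: "0 \<le> t" by (simp add: t_def)
  let ?Y = "\<lambda>h. W h ** spike v t ** transpose (W h)" and ?Y' = "\<lambda>h. W h ** spike v' t ** transpose (W h)"
  define P Q where "P = mat_log (LE_mean_map H W (spike v t))" and "Q = mat_log (LE_mean_map H W (spike v' t))"
  \<comment> \<open>The spike direction \<open>v\<close> comes from \<open>y\<close> through
    \<open>transpose (W 1)\<close>, so compression by \<open>W 1\<close> retains its small
    eigenvalue.\<close>
  have "?Y 1 *v y = exp (- t) *\<^sub>R y"
  proof -
    have "?Y 1 *v y = W 1 *v (spike v t *v v)"
      by (simp only: matrix_vector_mul_assoc[symmetric] v_def)
    also have "spike v t *v v = exp (- t) *\<^sub>R v"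
      using v(1) by (simp add: spike_mult dot_square_norm algebra_simps)
    finally show ?thesis by (simp only: matrix_vector_mult_scaleR v(2))
  qed
  then have "mat_log (?Y 1) *v y = - t *\<^sub>R y"
    using mat_log_eigenvector[OF compression_spd[OF W1 spike_spd], of "exp (- t)"] by simp
  then have Y1: "y \<bullet> (mat_log (?Y 1) *v y) = - t" by (simp add: yy)
  \<comment> \<open>Every compression is at most the identity, so the other summands cannot offset
    the drop at \<open>h = 1\<close>.\<close>
  have Yh: "y \<bullet> (mat_log (?Y h) *v y) \<le> (if h = 1 then - t else 0)" if "h \<in> {1..H}" for h
    using Y1 inner_mat_log_le[OF compression_spd[OF W[OF that] spike_spd, of v t] _
        compression_le[OF W[OF that] inner_spike_le[OF v(1) t]], of y] by simp
  have "y \<bullet> (P *v y) \<le> - t / real H"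
  proof -
    have "(\<Sum>h=1..H. y \<bullet> (mat_log (?Y h) *v y)) \<le> (\<Sum>h=1..H. if h = 1 then - t else 0)"
      by (rule sum_mono[OF Yh])
    also have "\<dots> = - t" using H by simp
    finally show ?thesis
      unfolding P_def inner_mat_log_LE_mean_map[OF W' spike_spd] by (intro divide_right_mono) auto
  qed
  moreover have "ln c \<le> y \<bullet> (Q *v y)"
  proof -
    have "ln c \<le> y \<bullet> (mat_log (?Y' h) *v y)" if h: "h \<in> {1..H}" for h
    proof -
      have "c * (x \<bullet> x) \<le> x \<bullet> (?Y' h *v x)" for x
        using mult_right_mono[OF c_le[OF h] inner_ge_zero[of x]] compression_spike_ge[OF W[OF h] v'(1), of x t]
        by linarith
      from inner_mat_log_ge[OF compression_spd[OF W[OF h] spike_spd] c this, of y] show ?thesis by (simp add: yy)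
    qed
    then have "(\<Sum>h=1..H. ln c) \<le> (\<Sum>h=1..H. y \<bullet> (mat_log (?Y' h) *v y))" by (rule sum_mono)
    then have "(\<Sum>h=1..H. ln c) / real H \<le> (\<Sum>h=1..H. y \<bullet> (mat_log (?Y' h) *v y)) / real H"
      by (rule divide_right_mono) simp
    then show ?thesis
      unfolding Q_def inner_mat_log_LE_mean_map[OF W' spike_spd] using H by simp
  qed
  ultimately have "ln c + t / real H \<le> y \<bullet> ((Q - P) *v y)"
    by (simp add: matrix_vector_mult_diff_rdistrib inner_diff_right)
  also have "\<dots> \<le> norm (Q - P)"
    using norm_cauchy_schwarz[of y "(Q - P) *v y"] norm_matrix_vector_mult_le[of "Q - P" y] by (simp add: y)
  also have "\<dots> = dist_LE (LE_mean_map H W (spike v' t)) (LE_mean_map H W (spike v t))"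
    by (simp add: dist_LE_def P_def Q_def)
  also have "\<dots> \<le> dist_LE (spike v' t) (spike v t)"
    using ne spike_spd unfolding nonexpansive_map_def by blast
  also have "\<dots> = t * norm (outer_square v' - outer_square v)" by (rule dist_LE_spike[OF t])
  also have "\<dots> \<le> t * (1 / (2 * real H))" using v'(2) t by (intro mult_left_mono) auto
  finally have "ln c + 2 * (1 + \<bar>ln c\<bar>) \<le> 1 + \<bar>ln c\<bar>" using H by (simp add: t_def)
  then have "ln c + 1 + \<bar>ln c\<bar> \<le> 0" by argo
  moreover have "0 \<le> ln c + \<bar>ln c\<bar>" using abs_ge_minus_self[of "ln c"] by argo
  ultimately show False by argo
qed

text \<open>The constant \<open>c\<close> may be negative; \<open>c < 1\<close> and nonnegativity of
  \<open>d\<close> already give \<open>c * d x y \<le> d x y\<close>.\<close>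

lemma contractive_imp_nonexpansive:
  assumes "contractive_map S d d' f" "\<And>x y. 0 \<le> d x y"
  shows "nonexpansive_map S d d' f"
proof -
  obtain c where c: "c < 1" "\<And>x y. x \<in> S \<Longrightarrow> y \<in> S \<Longrightarrow> d' (f x) (f y) \<le> c * d x y"
    using assms(1) unfolding contractive_map_def by blast
  have "c * d x y \<le> d x y" for x y
    using c(1) mult_right_mono[OF _ assms(2), of c 1 x y] by simp
  then show ?thesis using c(2) unfolding nonexpansive_map_def by (meson order_trans)
qed

theorem proposition2:
  fixes W :: "nat \<Rightarrow> real^'m^'k" and H :: nat
  assumes "CARD('k) < CARD('m)"
    and "H \<ge> 1"
    and "\<And>h. h \<in> {1..H} \<Longrightarrow> W h ** transpose (W h) = mat 1"
  shows "(\<forall>X\<in>spd. LE_mean_map H W X \<in> spd \<and>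
            is_LE_frechet_mean H (\<lambda>h. W h ** X ** transpose (W h)) (LE_mean_map H W X)) \<and>
         (\<forall>\<alpha> \<beta>. 0 < \<alpha> \<longrightarrow> \<alpha> \<le> \<beta> \<longrightarrow>
            (\<forall>X\<in>spd_between \<alpha> \<beta>. \<forall>Z\<in>spd_between \<alpha> \<beta>.
               dist_LE (LE_mean_map H W X) (LE_mean_map H W Z) \<le> \<beta> / \<alpha> * dist_LE X Z)) \<and>
         \<not> contractive_map spd dist_LE dist_LE (LE_mean_map H W) \<and>
         \<not> nonexpansive_map spd dist_LE dist_LE (LE_mean_map H W)"
proof (intro conjI ballI allI impI)
  fix X :: "real^'m^'m" assume X: "X \<in> spd"
  show mean: "is_LE_frechet_mean H (\<lambda>h. W h ** X ** transpose (W h)) (LE_mean_map H W X)"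
    unfolding LE_mean_map_def
    by (intro is_LE_frechet_mean_exp_mean_log compression_spd assms X)
  then show "LE_mean_map H W X \<in> spd" by (simp add: is_LE_frechet_mean_def)
next
  fix \<alpha> \<beta> :: real and X Z :: "real^'m^'m"
  assume "0 < \<alpha>" "X \<in> spd_between \<alpha> \<beta>" "Z \<in> spd_between \<alpha> \<beta>"
  with assms(2,3) show "dist_LE (LE_mean_map H W X) (LE_mean_map H W Z) \<le> \<beta> / \<alpha> * dist_LE X Z"
    by (rule dist_LE_mean_map_le)
next
  show *: "\<not> nonexpansive_map spd dist_LE dist_LE (LE_mean_map H W)"
    using assms by (rule not_nonexpansive_LE_mean_map)
  show "\<not> contractive_map spd dist_LE dist_LE (LE_mean_map H W)"
    using * contractive_imp_nonexpansive[of spd dist_LE] by (auto simp: dist_LE_def)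
qed

end
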